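(* Let $H$ be a separable Hilbert space, $1\le p<\infty$, and $S$ a compact operator on $H$. The following are equivalent: (a) $S\in S_p$; (b) $\{\langle Se_n,e_n\rangle\}\in\ell^p$ for every orthonormal basis $\{e_n\}$ of $H$; (c) $\{\langle Sf_n,f_n\rangle\}\in\ell^p$ for every frame $\{f_n\}$ of $H$. Furthermore, if $S$ is self-adjoint, then $$\|S\|_p^p=\sup\sum_{n=1}^\infty|\langle Se_n,e_n\rangle|^p=\sup\sum_{n=1}^\infty|\langle Sf_n,f_n\rangle|^p,$$ where the first supremum is over all orthonormal bases and the second over all frames with upper frame bound at most $1$.
   Context: A sequence $\{f_n\}$ in $H$ is a frame if there are constants $0<C_1\le C_2$ such that $C_1\|f\|^2\le\sum_n|\langle f,f_n\rangle|^2\le C_2\|f\|^2$ for all $f\in H$. The upper frame bound is the infimum of all admissible $C_2$. For a compact operator $T$, its singular values $\lambda_1\ge\lambda_2\ge\cdots$ are the positive eigenvalues of $(T^*T)^{1/2}$, repeated according to multiplicity. For $0<p<\infty$, $S_p$ is the set of compact $T$ with $\{\lambda_n\}\in\ell^p$, and $\|T\|_p=(\sum_n\lambda_n^p)^{1/p}$. *)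

theory Defs
  imports "HOL-Analysis.Analysis"
begin

class chilbert = banach +
  fixes scaleC :: "complex \<Rightarrow> 'a \<Rightarrow> 'a"
    and cinner :: "'a \<Rightarrow> 'a \<Rightarrow> complex"
  assumes scaleC_scaleR: "scaleC (complex_of_real r) x = scaleR r x"
    and scaleC_add_right: "scaleC a (x + y) = scaleC a x + scaleC a y"
    and scaleC_add_left: "scaleC (a + b) x = scaleC a x + scaleC b x"
    and scaleC_scaleC: "scaleC a (scaleC b x) = scaleC (a * b) x"
    and cinner_commute: "cinner x y = cnj (cinner y x)"
    and cinner_add_left: "cinner (x + y) z = cinner x z + cinner y z"
    and cinner_scaleC_left: "cinner (scaleC a x) y = a * cinner x y"
    and cinner_norm: "cinner x x = complex_of_real ((norm x)^2)"

definition separable :: "'a::chilbert itself \<Rightarrow> bool" where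
  "separable _ \<longleftrightarrow> (\<exists>D::'a set. countable D \<and> closure D = UNIV)"

definition clinear_op :: "('a::chilbert \<Rightarrow> 'a) \<Rightarrow> bool" where
  "clinear_op T \<longleftrightarrow> (\<forall>x y. T (x + y) = T x + T y) \<and> (\<forall>c x. T (scaleC c x) = scaleC c (T x))"

definition bounded_op :: "('a::chilbert \<Rightarrow> 'a) \<Rightarrow> bool" where
  "bounded_op T \<longleftrightarrow> clinear_op T \<and> (\<exists>K. \<forall>x. norm (T x) \<le> K * norm x)"

definition compact_op :: "('a::chilbert \<Rightarrow> 'a) \<Rightarrow> bool" where
  "compact_op T \<longleftrightarrow> clinear_op T \<and> compact (closure (T ` cball 0 1))"

definition self_adjoint :: "('a::chilbert \<Rightarrow> 'a) \<Rightarrow> bool" where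
  "self_adjoint T \<longleftrightarrow> (\<forall>x y. cinner (T x) y = cinner x (T y))"

definition adjoint :: "('a::chilbert \<Rightarrow> 'a) \<Rightarrow> ('a \<Rightarrow> 'a)" where
  "adjoint T = (THE T'. \<forall>x y. cinner (T x) y = cinner x (T' y))"

definition positive_op :: "('a::chilbert \<Rightarrow> 'a) \<Rightarrow> bool" where
  "positive_op T \<longleftrightarrow> bounded_op T \<and> (\<forall>x. Im (cinner (T x) x) = 0 \<and> Re (cinner (T x) x) \<ge> 0)"

definition abs_op :: "('a::chilbert \<Rightarrow> 'a) \<Rightarrow> ('a \<Rightarrow> 'a)" where
  "abs_op T = (THE R. positive_op R \<and> (\<forall>x. R (R x) = adjoint T (T x)))"

definition orthonormal :: "'a::chilbert set \<Rightarrow> bool" where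
  "orthonormal B \<longleftrightarrow> (\<forall>x\<in>B. cinner x x = 1) \<and> (\<forall>x\<in>B. \<forall>y\<in>B. x \<noteq> y \<longrightarrow> cinner x y = 0)"

definition onb :: "'a::chilbert set \<Rightarrow> bool" where
  "onb E \<longleftrightarrow> orthonormal E \<and> (\<forall>x. (\<forall>e\<in>E. cinner x e = 0) \<longrightarrow> x = 0)"

definition hdim :: "'a::chilbert set \<Rightarrow> ennreal" where
  "hdim V = (SUP B\<in>{B. finite B \<and> B \<subseteq> V \<and> orthonormal B}. of_nat (card B))"

definition eigenspace :: "('a::chilbert \<Rightarrow> 'a) \<Rightarrow> complex \<Rightarrow> 'a set" where
  "eigenspace T \<mu> = {x. T x = scaleC \<mu> x}"

definition singular_value_set :: "('a::chilbert \<Rightarrow> 'a) \<Rightarrow> real set" where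
  "singular_value_set T = {s. s > 0 \<and> eigenspace (abs_op T) (complex_of_real s) \<noteq> {0}}"

text \<open>schatten_pow p T = sum over singular values lambda_n (with multiplicity) of lambda_n^p,
  i.e. the quantity ||T||_p^p, valued in [0,\<infinity>].\<close>
definition schatten_pow :: "real \<Rightarrow> ('a::chilbert \<Rightarrow> 'a) \<Rightarrow> ennreal" where
  "schatten_pow p T = (\<Sum>\<^sub>\<infinity>s\<in>singular_value_set T.
      hdim (eigenspace (abs_op T) (complex_of_real s)) * ennreal (s powr p))"

definition in_Sp :: "real \<Rightarrow> ('a::chilbert \<Rightarrow> 'a) \<Rightarrow> bool" where
  "in_Sp p T \<longleftrightarrow> compact_op T \<and> schatten_pow p T < top"

definition frame_bounds :: "(nat \<Rightarrow> 'a::chilbert) \<Rightarrow> real \<Rightarrow> real \<Rightarrow> bool" where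
  "frame_bounds f C1 C2 \<longleftrightarrow> 0 < C1 \<and> C1 \<le> C2 \<and>
     (\<forall>x. summable (\<lambda>n. (cmod (cinner x (f n)))^2) \<and>
          C1 * (norm x)^2 \<le> (\<Sum>n. (cmod (cinner x (f n)))^2) \<and>
          (\<Sum>n. (cmod (cinner x (f n)))^2) \<le> C2 * (norm x)^2)"

definition frame :: "(nat \<Rightarrow> 'a::chilbert) \<Rightarrow> bool" where
  "frame f \<longleftrightarrow> (\<exists>C1 C2. frame_bounds f C1 C2)"

definition upper_frame_bound :: "(nat \<Rightarrow> 'a::chilbert) \<Rightarrow> real" where
  "upper_frame_bound f = Inf {C2. \<exists>C1. frame_bounds f C1 C2}"

end

theory Submission
  imports Defs
begin

text \<open>
  Let \<open>e\<close> range over an orthonormal eigenbasis of \<open>S\<^sup>* S\<close>, so that the singular values are the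
  \<open>\<sigma>\<^sub>e = \<parallel>S e\<parallel>\<close> and \<open>S e = \<sigma>\<^sub>e v\<^sub>e\<close> with \<open>v\<close> orthonormal where \<open>\<sigma>\<^sub>e > 0\<close>. For Bessel sequences
  \<open>f, g\<close> with bound \<open>C\<close>, AM-GM gives \<open>\<bar>\<langle>S f\<^sub>n, g\<^sub>n\<rangle>\<bar> \<le> \<Sum>\<^sub>e \<sigma>\<^sub>e w\<^sub>n\<^sub>e\<close> with weights
  \<open>w\<^sub>n\<^sub>e = (\<bar>\<langle>f\<^sub>n, e\<rangle>\<bar>\<^sup>2 + \<bar>\<langle>g\<^sub>n, v\<^sub>e\<rangle>\<bar>\<^sup>2) / 2\<close> whose row and column sums are at most \<open>C\<close>, and
  convexity of the \<open>p\<close>-th power yields \<open>\<Sum>\<^sub>n \<bar>\<langle>S f\<^sub>n, g\<^sub>n\<rangle>\<bar>\<^sup>p \<le> C\<^sup>p \<Sum>\<^sub>e \<sigma>\<^sub>e\<^sup>p\<close>. With \<open>g = f\<close> this is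
  (a) \<open>\<Rightarrow>\<close> (c) and the upper bound for both suprema; an eigenbasis of a self-adjoint \<open>S\<close> attains
  equality. An orthonormal basis is a frame with bounds \<open>1\<close>, whence (c) \<open>\<Rightarrow>\<close> (b). For (b) \<open>\<Rightarrow>\<close> (a),
  write \<open>S = A + \<i> B\<close> with \<open>A, B\<close> self-adjoint. As \<open>\<bar>\<langle>A e, e\<rangle>\<bar>, \<bar>\<langle>B e, e\<rangle>\<bar> \<le> \<bar>\<langle>S e, e\<rangle>\<bar>\<close>, the eigenbases
  of \<open>A\<close> and \<open>B\<close> show that both lie in the Schatten class, and the inequality above with
  \<open>g\<^sub>e = v\<^sub>e\<close>, where \<open>\<sigma>\<^sub>e = \<langle>S e, v\<^sub>e\<rangle>\<close>, shows that this class is closed under sums.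
\<close>

section \<open>Complex inner products\<close>

lemma scaleC_one: "scaleC 1 x = (x::'a::chilbert)"
  using scaleC_scaleR[of 1 x] by simp

lemma scaleC_real_scaleR: "scaleC a (r *\<^sub>R x) = r *\<^sub>R scaleC a (x::'a::chilbert)"
  by (metis scaleC_scaleC scaleC_scaleR mult.commute)

lemma cinner_add_right: "cinner (x::'a::chilbert) (y + z) = cinner x y + cinner x z"
  by (metis cinner_add_left cinner_commute complex_cnj_add)

lemma cinner_scaleC_right: "cinner (x::'a::chilbert) (scaleC a y) = cnj a * cinner x y"
  by (metis cinner_scaleC_left cinner_commute complex_cnj_mult)

lemma cmod_cinner_commute: "cmod (cinner x y) = cmod (cinner y (x::'a::chilbert))"
  by (metis cinner_commute complex_mod_cnj)

lemma power2_norm_eq_Re_cinner: "(norm (x::'a::chilbert))\<^sup>2 = Re (cinner x x)"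
  by (simp add: cinner_norm)

lemma norm_scaleC: "norm (scaleC a x) = cmod a * norm (x::'a::chilbert)"
proof (rule power2_eq_imp_eq)
  have "cinner (scaleC a x) (scaleC a x) = (a * cnj a) * cinner x x"
    by (simp add: cinner_scaleC_left cinner_scaleC_right)
  also have "\<dots> = complex_of_real ((cmod a * norm x)\<^sup>2)"
    by (simp only: complex_norm_square[symmetric] cinner_norm of_real_mult[symmetric] power_mult_distrib)
  finally show "(norm (scaleC a x))\<^sup>2 = (cmod a * norm x)\<^sup>2"
    by (simp only: cinner_norm of_real_eq_iff)
qed simp_all

lemma cauchy_schwarz_cinner: "cmod (cinner x y) \<le> norm x * norm (y::'a::chilbert)"
proof (cases "y = 0")
  case True
  then have "cinner y x = 0"
    using cinner_add_left[of 0 0 x] by simp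
  then show ?thesis
    by (simp add: cmod_cinner_commute[of x])
next
  case False
  define a where "a = cinner x y"
  define z where "z = scaleC ((norm y)\<^sup>2) x + scaleC (- a) y"
  have a_mult_cnj: "a * cnj a = complex_of_real ((cmod a)\<^sup>2)"
    by (rule complex_norm_square[symmetric])
  have cinner_yx: "cinner y x = cnj a"
    unfolding a_def by (rule cinner_commute)
  have "cinner z z = complex_of_real ((norm y)\<^sup>2 * ((norm x)\<^sup>2 * (norm y)\<^sup>2 - (cmod a)\<^sup>2))"
    unfolding z_def of_real_mult of_real_diff a_mult_cnj[symmetric]
    by (simp add: cinner_add_left cinner_add_right cinner_scaleC_left cinner_scaleC_right cinner_yx
        cinner_norm[of x] cinner_norm[of y] a_def[symmetric] algebra_simps)
  then have "(norm y)\<^sup>2 * ((norm x)\<^sup>2 * (norm y)\<^sup>2 - (cmod a)\<^sup>2) \<ge> 0"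
    unfolding cinner_norm of_real_eq_iff by (metis zero_le_power2)
  then have "(cmod a)\<^sup>2 \<le> (norm x * norm y)\<^sup>2"
    using False by (simp add: zero_le_mult_iff power_mult_distrib)
  then show ?thesis
    unfolding a_def by (rule power2_le_imp_le) simp
qed

interpretation scaleC: bounded_bilinear "scaleC :: complex \<Rightarrow> 'a::chilbert \<Rightarrow> 'a"
proof
  show "scaleC (r *\<^sub>R a) x = r *\<^sub>R scaleC a x" for r a and x :: 'a
    by (metis scaleC_scaleC scaleC_scaleR scaleR_conv_of_real)
  show "\<exists>K. \<forall>a (x::'a). norm (scaleC a x) \<le> cmod a * norm x * K"
    by (intro exI[of _ 1]) (simp add: norm_scaleC)
qed (fact scaleC_add_left scaleC_add_right scaleC_real_scaleR)+

interpretation cinner: bounded_bilinear "cinner :: 'a::chilbert \<Rightarrow> 'a \<Rightarrow> complex"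
proof
  show "cinner (r *\<^sub>R x) y = r *\<^sub>R cinner x y" "cinner x (r *\<^sub>R y) = r *\<^sub>R cinner x y"
    for r and x y :: 'a
    by (simp_all add: scaleC_scaleR[symmetric] cinner_scaleC_left cinner_scaleC_right
        scaleR_conv_of_real)
  show "\<exists>K. \<forall>x y :: 'a. cmod (cinner x y) \<le> norm x * norm y * K"
    by (intro exI[of _ 1]) (simp add: cauchy_schwarz_cinner)
qed (fact cinner_add_left cinner_add_right)+

lemmas cinner_simps = cinner.add_left cinner.add_right cinner.diff_left cinner.diff_right
  cinner.minus_left cinner.minus_right cinner.scaleR_left cinner.scaleR_right
  cinner.zero_left cinner.zero_right cinner.sum_left cinner.sum_right
  cinner_scaleC_left cinner_scaleC_right

lemma Re_cinner_commute: "Re (cinner x y) = Re (cinner y (x::'a::chilbert))"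
  by (metis cinner_commute cnj.simps(1))

lemma power2_norm_add:
  "(norm (x + y))\<^sup>2 = (norm x)\<^sup>2 + (norm y)\<^sup>2 + 2 * Re (cinner x (y::'a::chilbert))"
  by (simp add: power2_norm_eq_Re_cinner cinner_simps Re_cinner_commute[of y x])

lemma power2_norm_diff:
  "(norm (x - y))\<^sup>2 = (norm x)\<^sup>2 + (norm y)\<^sup>2 - 2 * Re (cinner x (y::'a::chilbert))"
  by (simp add: power2_norm_eq_Re_cinner cinner_simps Re_cinner_commute[of y x])

lemma cinner_ext:
  assumes "\<And>y. cinner (x::'a::chilbert) y = cinner x' y"
  shows "x = x'"
proof -
  have "cinner (x - x') (x - x') = 0"
    using assms by (simp add: cinner_simps)
  then show ?thesis
    by (simp add: cinner_norm)
qed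

section \<open>Orthogonal families and Bessel families\<close>

lemma cinner_self_eq_1_iff: "cinner x x = 1 \<longleftrightarrow> norm (x::'a::chilbert) = 1"
  unfolding cinner_norm of_real_eq_1_iff by (rule abs_square_eq_1[THEN trans]) simp

lemma orthonormal_iff_pairwise:
  "orthonormal E \<longleftrightarrow> (\<forall>e\<in>E. norm (e::'a::chilbert) = 1) \<and> pairwise (\<lambda>e e'. cinner e e' = 0) E"
  by (auto simp: orthonormal_def pairwise_def cinner_self_eq_1_iff)

lemma orthonormal_norm: "orthonormal E \<Longrightarrow> e \<in> E \<Longrightarrow> norm (e::'a::chilbert) = 1"
  by (simp add: orthonormal_iff_pairwise)

lemma orthonormal_cinner:
  "orthonormal E \<Longrightarrow> e \<in> E \<Longrightarrow> e' \<in> E \<Longrightarrow> cinner e (e'::'a::chilbert) = (if e = e' then 1 else 0)"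
  unfolding orthonormal_def by auto

lemma orthonormal_subset: "orthonormal E \<Longrightarrow> F \<subseteq> E \<Longrightarrow> orthonormal F"
  unfolding orthonormal_def by (meson subsetD)

lemma power2_norm_sum_orthogonal:
  fixes a :: "'i \<Rightarrow> 'a::chilbert"
  assumes "finite F" "pairwise (\<lambda>i j. cinner (a i) (a j) = 0) F"
  shows "(norm (sum a F))\<^sup>2 = (\<Sum>i\<in>F. (norm (a i))\<^sup>2)"
  using assms
proof (induction F rule: finite_induct)
  case (insert i F)
  have "cinner (a i) (sum a F) = 0"
    unfolding cinner.sum_right using insert.hyps insert.prems
    by (intro sum.neutral) (auto simp: pairwise_insert)
  then show ?case
    using insert by (simp add: power2_norm_add pairwise_insert)
qed simp

definition bessel_on :: "real \<Rightarrow> ('i \<Rightarrow> 'a::chilbert) \<Rightarrow> 'i set \<Rightarrow> bool" where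
  "bessel_on C f N \<longleftrightarrow>
     (\<forall>F x. finite F \<longrightarrow> F \<subseteq> N \<longrightarrow> (\<Sum>n\<in>F. (cmod (cinner x (f n)))\<^sup>2) \<le> C * (norm x)\<^sup>2)"

lemma bessel_onD:
  "bessel_on C f N \<Longrightarrow> finite F \<Longrightarrow> F \<subseteq> N \<Longrightarrow> (\<Sum>n\<in>F. (cmod (cinner x (f n)))\<^sup>2) \<le> C * (norm x)\<^sup>2"
  unfolding bessel_on_def by blast

lemma bessel_on_norm:
  assumes "bessel_on C f N" "n \<in> N" "C \<ge> 0"
  shows "(norm (f n))\<^sup>2 \<le> C"
proof (cases "f n = 0")
  case False
  have "(norm (f n))\<^sup>2 * (norm (f n))\<^sup>2 \<le> C * (norm (f n))\<^sup>2"
    using bessel_onD[OF assms(1), of "{n}" "f n"] assms(2)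
    by (simp add: cinner_norm norm_power power2_eq_square[of "(norm (f n))\<^sup>2"])
  then show ?thesis
    by (rule mult_right_le_imp_le) (use False in simp)
qed (use assms in simp)

lemma bessel_on_summable:
  assumes "bessel_on C f N"
  shows "(\<lambda>n. (cmod (cinner x (f n)))\<^sup>2) summable_on N"
  using bessel_onD[OF assms]
  by (intro nonneg_bdd_above_summable_on bdd_aboveI2[where M="C * (norm x)\<^sup>2"]) auto

lemma bessel_on_orthogonal:
  fixes a :: "'i \<Rightarrow> 'a::chilbert"
  assumes orthogonal: "pairwise (\<lambda>i j. cinner (a i) (a j) = 0) N"
    and norm_le_1: "\<And>i. i \<in> N \<Longrightarrow> norm (a i) \<le> 1"
  shows "bessel_on 1 a N"
  unfolding bessel_on_def
proof (intro allI impI)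
  fix F x assume F: "finite F" "F \<subseteq> N"
  define t where "t = (\<Sum>i\<in>F. (cmod (cinner x (a i)))\<^sup>2)"
  define s where "s = (\<Sum>i\<in>F. scaleC (cinner x (a i)) (a i))"
  have "pairwise (\<lambda>i j. cinner (a i) (a j) = 0) F"
    using orthogonal F(2) by (rule pairwise_subset)
  then have "pairwise (\<lambda>i j.
      cinner (scaleC (cinner x (a i)) (a i)) (scaleC (cinner x (a j)) (a j)) = 0) F"
    by (auto simp: pairwise_def cinner_simps)
  then have "(norm s)\<^sup>2 = (\<Sum>i\<in>F. (cmod (cinner x (a i)) * norm (a i))\<^sup>2)"
    unfolding s_def using F(1) by (simp add: power2_norm_sum_orthogonal norm_scaleC)
  also have "\<dots> \<le> t"
    unfolding t_def using F norm_le_1 by (intro sum_mono power_mono mult_left_le) auto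
  finally have s_le_t: "(norm s)\<^sup>2 \<le> t" .
  have "cinner x s = complex_of_real t"
    unfolding s_def t_def
    by (simp add: cinner_simps complex_norm_square mult.commute del: of_real_power)
  then have "(norm (x - s))\<^sup>2 = (norm x)\<^sup>2 + (norm s)\<^sup>2 - 2 * t"
    by (simp add: power2_norm_diff)
  then show "t \<le> 1 * (norm x)\<^sup>2"
    using s_le_t zero_le_power2[of "norm (x - s)"] by linarith
qed

lemma bessel_on_orthonormal: "orthonormal E \<Longrightarrow> bessel_on 1 (\<lambda>e. e) E"
  by (intro bessel_on_orthogonal) (auto simp: orthonormal_iff_pairwise)

lemma summable_on_CauchyI:
  fixes a :: "'i \<Rightarrow> 'a::banach"
  assumes Cauchy: "\<And>\<epsilon>. \<epsilon> > 0 \<Longrightarrow> \<exists>F0. finite F0 \<and> F0 \<subseteq> E \<and>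
    (\<forall>F. finite F \<longrightarrow> F0 \<subseteq> F \<longrightarrow> F \<subseteq> E \<longrightarrow> norm (sum a (F - F0)) < \<epsilon>)"
  shows "a summable_on E"
proof -
  have "\<exists>P. eventually P (finite_subsets_at_top E) \<and>
          (\<forall>F F'. P F \<and> P F' \<longrightarrow> dist (sum a F) (sum a F') < \<epsilon>)" if "\<epsilon> > 0" for \<epsilon>
  proof -
    obtain F0 where F0: "finite F0" "F0 \<subseteq> E"
      and tail: "\<And>F. finite F \<Longrightarrow> F0 \<subseteq> F \<Longrightarrow> F \<subseteq> E \<Longrightarrow> norm (sum a (F - F0)) < \<epsilon>/2"
      using Cauchy[of "\<epsilon>/2"] \<open>\<epsilon> > 0\<close> by auto
    define P where "P F \<longleftrightarrow> finite F \<and> F0 \<subseteq> F \<and> F \<subseteq> E" for F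
    have "dist (sum a F) (sum a F0) < \<epsilon>/2" if "P F" for F
      using tail[of F] that F0 by (simp add: P_def dist_norm sum_diff)
    then have "dist (sum a F) (sum a F') < \<epsilon>" if "P F" "P F'" for F F'
      using that by (blast intro: dist_triangle_half_l)
    moreover have "eventually P (finite_subsets_at_top E)"
      unfolding eventually_finite_subsets_at_top P_def using F0 by blast
    ultimately show ?thesis
      by blast
  qed
  then have "cauchy_filter (filtermap (sum a) (finite_subsets_at_top E))"
    unfolding cauchy_filter_metric_filtermap by blast
  then obtain l where "(sum a \<longlongrightarrow> l) (finite_subsets_at_top E)"
    using complete_UNIV[where 'a='a] complete_uniform[where S="UNIV::'a set"]
    by (force simp: filterlim_def)
  then show ?thesis
    using summable_on_def has_sum_def by blast
qed

text \<open>The Cauchy criterion holds because the squared norm of a block of an orthogonal series is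
  the corresponding block of the series of squared norms.\<close>
lemma orthogonal_summable_on:
  fixes a :: "'i \<Rightarrow> 'a::chilbert"
  assumes orthogonal: "pairwise (\<lambda>i j. cinner (a i) (a j) = 0) E"
    and summable: "(\<lambda>i. (norm (a i))\<^sup>2) summable_on E"
  shows "a summable_on E"
proof (rule summable_on_CauchyI)
  fix \<epsilon> :: real assume "\<epsilon> > 0"
  obtain L where L: "((\<lambda>i. (norm (a i))\<^sup>2) has_sum L) E"
    using summable unfolding summable_on_def by blast
  obtain F0 where F0: "finite F0" "F0 \<subseteq> E" "dist (\<Sum>i\<in>F0. (norm (a i))\<^sup>2) L \<le> (\<epsilon>/2)\<^sup>2"
    using has_sum_finite_approximation[OF L, of "(\<epsilon>/2)\<^sup>2"] \<open>\<epsilon> > 0\<close> by auto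
  have "norm (sum a (F - F0)) < \<epsilon>" if F: "finite F" "F0 \<subseteq> F" "F \<subseteq> E" for F
  proof (rule power_less_imp_less_base)
    have "(norm (sum a (F - F0)))\<^sup>2 = (\<Sum>i\<in>F - F0. (norm (a i))\<^sup>2)"
      using F pairwise_subset[OF orthogonal, of "F - F0"] by (intro power2_norm_sum_orthogonal) auto
    also have "\<dots> = (\<Sum>i\<in>F. (norm (a i))\<^sup>2) - (\<Sum>i\<in>F0. (norm (a i))\<^sup>2)"
      using F F0 by (simp add: sum_diff)
    also have "\<dots> \<le> (\<epsilon>/2)\<^sup>2"
      using finite_sum_le_has_sum[OF L F(1,3)] F0(3) by (simp add: dist_real_def)
    also have "\<dots> < \<epsilon>\<^sup>2"
      using \<open>\<epsilon> > 0\<close> by (simp add: power_divide)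
    finally show "(norm (sum a (F - F0)))\<^sup>2 < \<epsilon>\<^sup>2" .
  qed (use \<open>\<epsilon> > 0\<close> in simp)
  with F0 show "\<exists>F0. finite F0 \<and> F0 \<subseteq> E \<and>
      (\<forall>F. finite F \<longrightarrow> F0 \<subseteq> F \<longrightarrow> F \<subseteq> E \<longrightarrow> norm (sum a (F - F0)) < \<epsilon>)"
    by blast
qed

section \<open>Orthonormal bases\<close>

lemma riesz_fischer:
  fixes E :: "'a::chilbert set"
  assumes E: "orthonormal E" and coefficients_summable: "(\<lambda>e. (cmod (c e))\<^sup>2) summable_on E"
  obtains x where "((\<lambda>e. scaleC (c e) e) has_sum x) E" "\<And>e. e \<in> E \<Longrightarrow> cinner x e = c e"
proof -
  have "(\<lambda>e. scaleC (c e) e) summable_on E"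
  proof (rule orthogonal_summable_on)
    show "pairwise (\<lambda>e e'. cinner (scaleC (c e) e) (scaleC (c e') e') = 0) E"
      using E by (auto simp: orthonormal_iff_pairwise pairwise_def cinner_simps)
    show "(\<lambda>e. (norm (scaleC (c e) e))\<^sup>2) summable_on E"
      using coefficients_summable by (rule summable_on_cong[THEN iffD1, rotated])
        (simp add: norm_scaleC orthonormal_norm[OF E])
  qed
  then obtain x where x: "((\<lambda>e. scaleC (c e) e) has_sum x) E"
    unfolding summable_on_def by blast
  have "cinner x e = c e" if "e \<in> E" for e
  proof (rule has_sum_unique)
    show "((\<lambda>e'. cinner (scaleC (c e') e') e) has_sum cinner x e) E"
      by (rule has_sum_bounded_linear[OF cinner.bounded_linear_left x])
    show "((\<lambda>e'. cinner (scaleC (c e') e') e) has_sum c e) E"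
      using that E by (intro has_sum_finite_neutralI[where B="{e}"])
        (auto simp: cinner_simps orthonormal_cinner)
  qed
  with x show thesis
    by (rule that)
qed

definition orthogonal_complement :: "'a::chilbert set \<Rightarrow> 'a set" where
  "orthogonal_complement E = {x. \<forall>e\<in>E. cinner x e = 0}"

lemma closed_orthogonal_complement: "closed (orthogonal_complement E)"
proof -
  have "closed ((\<lambda>x::'a. cinner x e) -` {0})" for e
    by (intro closed_vimage closed_singleton linear_continuous_on cinner.bounded_linear_left)
  moreover have "orthogonal_complement E = (\<Inter>e\<in>E. (\<lambda>x. cinner x e) -` {0})"
    by (auto simp: orthogonal_complement_def)
  ultimately show ?thesis
    by (simp add: closed_INT)
qed

lemma subspace_orthogonal_complement: "subspace (orthogonal_complement E)"
  by (simp add: subspace_def orthogonal_complement_def cinner_simps)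

lemma orthonormal_insert:
  assumes "orthonormal E" "norm x = 1" "x \<in> orthogonal_complement E"
  shows "orthonormal (insert x E)"
proof -
  have "cinner x e = 0" "cinner e x = 0" if "e \<in> E" for e
    using assms(3) that cinner_commute[of e x] by (auto simp: orthogonal_complement_def)
  with assms(1,2) show ?thesis
    by (simp add: orthonormal_iff_pairwise pairwise_insert)
qed

lemma maximal_orthonormal_subset_exists:
  fixes V :: "'a::chilbert set"
  shows "\<exists>E\<subseteq>V. orthonormal E \<and> (\<forall>x\<in>V. norm x = 1 \<longrightarrow> x \<notin> orthogonal_complement E)"
proof -
  define \<A> where "\<A> = {E. E \<subseteq> V \<and> orthonormal E}"
  have "\<exists>E\<in>\<A>. \<forall>X\<in>\<A>. E \<subseteq> X \<longrightarrow> X = E"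
  proof (rule Zorn_Lemma, intro ballI)
    fix \<C> assume "\<C> \<in> chains \<A>"
    then have chain: "chain\<^sub>\<subseteq> \<C>" and members: "\<And>E. E \<in> \<C> \<Longrightarrow> E \<subseteq> V \<and> orthonormal E"
      by (auto simp: chains_def \<A>_def)
    have "pairwise (\<lambda>e e'. cinner e e' = 0) (\<Union>\<C>)"
      using members chain by (intro pairwise_chain_Union) (simp_all add: orthonormal_iff_pairwise)
    then show "\<Union>\<C> \<in> \<A>"
      unfolding \<A>_def using members by (simp add: orthonormal_iff_pairwise Sup_le_iff)
  qed
  then obtain E where E: "E \<subseteq> V" "orthonormal E"
    and maximal: "\<And>X. X \<subseteq> V \<Longrightarrow> orthonormal X \<Longrightarrow> E \<subseteq> X \<Longrightarrow> X = E"
    unfolding \<A>_def by auto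
  have "x \<notin> orthogonal_complement E" if x: "x \<in> V" "norm x = 1" for x
  proof
    assume orthogonal: "x \<in> orthogonal_complement E"
    then have "insert x E = E"
      using E x by (intro maximal orthonormal_insert) auto
    then have "cinner x x = 0"
      using orthogonal by (auto simp: orthogonal_complement_def)
    then show False
      using x(2) by (simp add: cinner_norm)
  qed
  with E show ?thesis
    by blast
qed

lemma onb_iff_orthogonal_complement: "onb E \<longleftrightarrow> orthonormal E \<and> orthogonal_complement E \<subseteq> {0}"
  by (auto simp: onb_def orthogonal_complement_def)

lemma onb_orthonormal: "onb E \<Longrightarrow> orthonormal E"
  by (simp add: onb_def)

lemma onb_exists: "\<exists>E::'a::chilbert set. onb E"
proof -
  obtain E :: "'a set" where "orthonormal E"
    and maximal: "\<And>x. norm x = 1 \<Longrightarrow> x \<notin> orthogonal_complement E"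
    using maximal_orthonormal_subset_exists[of "UNIV::'a set"] by blast
  have "x = 0" if "x \<in> orthogonal_complement E" for x
  proof (rule ccontr)
    assume "x \<noteq> 0"
    then have "sgn x \<notin> orthogonal_complement E"
      by (intro maximal) (simp add: norm_sgn)
    then show False
      using subspace_scale[OF subspace_orthogonal_complement that] by (simp add: sgn_div_norm)
  qed
  then show ?thesis
    using \<open>orthonormal E\<close> by (auto simp: onb_iff_orthogonal_complement)
qed

lemma onb_eqI:
  assumes "onb E" "\<And>e. e \<in> E \<Longrightarrow> cinner x e = cinner y e"
  shows "x = y"
proof -
  have "x - y \<in> orthogonal_complement E"
    using assms(2) by (simp add: orthogonal_complement_def cinner_simps)
  then show ?thesis
    using assms(1) by (auto simp: onb_iff_orthogonal_complement)
qed

lemma onb_summable: "onb E \<Longrightarrow> (\<lambda>e. (cmod (cinner x e))\<^sup>2) summable_on E"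
  by (rule bessel_on_summable[OF bessel_on_orthonormal[OF onb_orthonormal]])

lemma onb_expansion:
  assumes "onb E"
  shows "((\<lambda>e. scaleC (cinner x e) e) has_sum x) E"
proof -
  obtain y where y: "((\<lambda>e. scaleC (cinner x e) e) has_sum y) E"
      "\<And>e. e \<in> E \<Longrightarrow> cinner y e = cinner x e"
    using riesz_fischer[OF onb_orthonormal[OF assms] onb_summable[OF assms]] by blast
  then have "y = x"
    by (intro onb_eqI[OF assms])
  with y(1) show ?thesis
    by simp
qed

lemma parseval:
  assumes "onb E"
  shows "((\<lambda>e. cinner x e * cinner e y) has_sum cinner x y) E"
  using has_sum_bounded_linear[OF cinner.bounded_linear_left onb_expansion[OF assms]]
  by (simp add: cinner_scaleC_left)

lemma parseval_norm:
  assumes "onb E"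
  shows "((\<lambda>e. (cmod (cinner x e))\<^sup>2) has_sum (norm x)\<^sup>2) E"
proof -
  have "Re (cinner x e * cinner e x) = (cmod (cinner x e))\<^sup>2" for e
    by (subst (2) cinner_commute) (simp add: cmod_def power2_eq_square[symmetric])
  then show ?thesis
    using has_sum_Re[OF parseval[OF assms, of x x]] by (simp add: power2_norm_eq_Re_cinner)
qed

lemma parseval_norm_subset:
  assumes "onb E" "F \<subseteq> E" "x \<in> orthogonal_complement (E - F)"
  shows "((\<lambda>e. (cmod (cinner x e))\<^sup>2) has_sum (norm x)\<^sup>2) F"
proof -
  have "((\<lambda>e. (cmod (cinner x e))\<^sup>2) has_sum (norm x)\<^sup>2) F \<longleftrightarrow>
      ((\<lambda>e. (cmod (cinner x e))\<^sup>2) has_sum (norm x)\<^sup>2) E"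
    using assms(2,3) by (intro has_sum_cong_neutral) (auto simp: orthogonal_complement_def)
  with parseval_norm[OF assms(1)] show ?thesis
    by simp
qed

lemma orthonormal_countable:
  fixes E :: "'a::chilbert set"
  assumes "separable TYPE('a)" "orthonormal E"
  shows "countable E"
proof -
  obtain D :: "'a set" where D: "countable D" "closure D = UNIV"
    using assms(1) unfolding separable_def by blast
  have "\<exists>d\<in>D. dist d e < 1/2" for e
    using D(2) closure_approachable[of e D] by (metis UNIV_I half_gt_zero_iff zero_less_one)
  then obtain d where d: "\<And>e. d e \<in> D" "\<And>e. dist (d e) e < 1/2"
    by metis
  have "inj_on d E"
  proof (rule inj_onI, rule ccontr)
    fix e e' assume e: "e \<in> E" "e' \<in> E" "d e = d e'" "e \<noteq> e'"
    have "dist e e' < 1"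
      using d(2)[of e] d(2)[of e'] dist_triangle3[of e e' "d e"] e(3) by simp
    then have "(norm (e - e'))\<^sup>2 < 1"
      by (simp add: dist_norm power_less_one_iff)
    moreover have "(norm (e - e'))\<^sup>2 = 2"
      using e orthonormal_norm[OF assms(2)] orthonormal_cinner[OF assms(2) e(1,2)]
      by (simp add: power2_norm_diff)
    ultimately show False
      by simp
  qed
  moreover have "countable (d ` E)"
    using D(1) d(1) by (meson countable_subset image_subsetI)
  ultimately show ?thesis
    by (rule countable_image_inj_on[rotated])
qed

section \<open>Bounded operators and adjoints\<close>

lemma bounded_op_iff:
  "bounded_op T \<longleftrightarrow> bounded_linear T \<and> (\<forall>c x. T (scaleC c x) = scaleC c (T x))"
proof
  assume "bounded_op T"
  then obtain K where T: "\<And>x y. T (x + y) = T x + T y" "\<And>c x. T (scaleC c x) = scaleC c (T x)"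
      "\<And>x. norm (T x) \<le> K * norm x"
    unfolding bounded_op_def clinear_op_def by blast
  have "bounded_linear T"
    by (rule bounded_linear_intro[where K=K]) (simp_all add: T mult.commute flip: scaleC_scaleR)
  with T show "bounded_linear T \<and> (\<forall>c x. T (scaleC c x) = scaleC c (T x))"
    by blast
next
  assume T: "bounded_linear T \<and> (\<forall>c x. T (scaleC c x) = scaleC c (T x))"
  then have "\<forall>x. norm (T x) \<le> onorm T * norm x"
    using onorm by blast
  with T show "bounded_op T"
    unfolding bounded_op_def clinear_op_def by (blast intro: linear_add bounded_linear.linear)
qed

lemma bounded_op_bounded_linear: "bounded_op T \<Longrightarrow> bounded_linear T"
  by (simp add: bounded_op_iff)

lemma bounded_op_commute_scaleC: "bounded_op T \<Longrightarrow> T (scaleC c x) = scaleC c (T x)"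
  by (simp add: bounded_op_iff)

lemma bounded_op_norm_le: "bounded_op T \<Longrightarrow> norm (T x) \<le> onorm T * norm x"
  by (simp add: onorm bounded_op_iff)

lemma bounded_op_comp: "bounded_op S \<Longrightarrow> bounded_op T \<Longrightarrow> bounded_op (\<lambda>x. S (T x))"
  by (simp add: bounded_op_iff bounded_linear_compose)

lemma bounded_op_add: "bounded_op S \<Longrightarrow> bounded_op T \<Longrightarrow> bounded_op (\<lambda>x. S x + T x)"
  by (simp add: bounded_op_iff bounded_linear_add scaleC.add_right)

lemma bounded_op_scaleC: "bounded_op (scaleC c)"
  by (simp add: bounded_op_iff scaleC.bounded_linear_right scaleC_scaleC mult.commute)

lemma bounded_op_expansion:
  assumes "onb E" "bounded_op T"
  shows "((\<lambda>e. scaleC (cinner x e) (T e)) has_sum T x) E"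
  using has_sum_bounded_linear[OF bounded_op_bounded_linear[OF assms(2)] onb_expansion[OF assms(1)]]
  by (simp add: bounded_op_commute_scaleC[OF assms(2)])

lemma bounded_op_eq_on_onb:
  assumes "onb E" "bounded_op S" "bounded_op T" "\<And>e. e \<in> E \<Longrightarrow> S e = T e"
  shows "S = T"
proof
  fix x
  have "((\<lambda>e. scaleC (cinner x e) (S e)) has_sum T x) E"
    using bounded_op_expansion[OF assms(1,3)] assms(4) by (simp cong: has_sum_cong)
  with bounded_op_expansion[OF assms(1,2)] show "S x = T x"
    by (rule has_sum_unique)
qed

lemma bounded_functional_bessel:
  fixes \<phi> :: "'a::chilbert \<Rightarrow> complex"
  assumes bounded: "bounded_linear \<phi>" and \<phi>_scaleC: "\<And>c x. \<phi> (scaleC c x) = c * \<phi> x"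
    and F: "finite F" "orthonormal F"
  shows "(\<Sum>e\<in>F. (cmod (\<phi> e))\<^sup>2) \<le> (onorm \<phi>)\<^sup>2" (is "?t \<le> _")
proof -
  interpret \<phi>: bounded_linear \<phi>
    by (fact bounded)
  define z where "z = (\<Sum>e\<in>F. scaleC (cnj (\<phi> e)) e)"
  have "pairwise (\<lambda>e e'. cinner (scaleC (cnj (\<phi> e)) e) (scaleC (cnj (\<phi> e')) e') = 0) F"
    using F(2) by (auto simp: orthonormal_iff_pairwise pairwise_def cinner_simps)
  then have norm_z: "(norm z)\<^sup>2 = ?t"
    unfolding z_def using F(1) orthonormal_norm[OF F(2)]
    by (simp add: power2_norm_sum_orthogonal norm_scaleC)
  have "\<phi> z = complex_of_real ?t"
    unfolding z_def by (simp add: \<phi>.sum \<phi>_scaleC complex_norm_square mult.commute del: of_real_power)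
  then have "(norm z)\<^sup>2 = cmod (\<phi> z)"
    unfolding norm_z by (simp add: sum_nonneg del: of_real_sum)
  also have "\<dots> \<le> onorm \<phi> * norm z"
    by (rule onorm[OF bounded])
  finally have "norm z \<le> onorm \<phi>"
    using onorm_pos_le[OF bounded] by (cases "z = 0") (simp_all add: power2_eq_square)
  then show ?thesis
    unfolding norm_z[symmetric] by (intro power_mono) auto
qed

lemma riesz_representation:
  fixes \<phi> :: "'a::chilbert \<Rightarrow> complex"
  assumes bounded: "bounded_linear \<phi>" and \<phi>_scaleC: "\<And>c x. \<phi> (scaleC c x) = c * \<phi> x"
  obtains z where "\<And>x. \<phi> x = cinner x z"
proof -
  obtain E :: "'a set" where E: "onb E"
    using onb_exists by blast
  have "(\<lambda>e. (cmod (cnj (\<phi> e)))\<^sup>2) summable_on E"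
    using bounded_functional_bessel[OF assms] orthonormal_subset[OF onb_orthonormal[OF E]]
    by (intro nonneg_bdd_above_summable_on bdd_aboveI2[where M="(onorm \<phi>)\<^sup>2"]) auto
  then obtain z where z: "\<And>e. e \<in> E \<Longrightarrow> cinner z e = cnj (\<phi> e)"
    using riesz_fischer[OF onb_orthonormal[OF E]] by metis
  have "\<phi> x = cinner x z" for x
  proof (rule has_sum_unique)
    show "((\<lambda>e. cinner x e * \<phi> e) has_sum \<phi> x) E"
      using has_sum_bounded_linear[OF bounded onb_expansion[OF E, of x]] by (simp add: \<phi>_scaleC)
    have "\<phi> e = cinner e z" if "e \<in> E" for e
      using z[OF that] cinner_commute[of e z] by simp
    then show "((\<lambda>e. cinner x e * \<phi> e) has_sum cinner x z) E"
      using parseval[OF E, of x z] by (simp cong: has_sum_cong)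
  qed
  then show thesis
    by (rule that)
qed

lemma adjoint_eqI:
  assumes "\<And>x y. cinner (T x) y = cinner x (T' y)"
  shows "adjoint T = T'"
  unfolding adjoint_def
proof (rule the_equality)
  fix R assume R: "\<forall>x y. cinner (T x) y = cinner x (R y)"
  have "cinner (R y) z = cinner (T' y) z" for y z
    using R assms by (metis cinner_commute)
  then show "R = T'"
    using cinner_ext by blast
qed (use assms in blast)

lemma cinner_adjoint_right:
  assumes "bounded_op T"
  shows "cinner x (adjoint T y) = cinner (T x) y"
proof -
  have "\<exists>z. \<forall>x. cinner (T x) y = cinner x z" for y
  proof (rule riesz_representation)
    show "bounded_linear (\<lambda>x. cinner (T x) y)"
      using assms
      by (intro bounded_linear_compose[OF cinner.bounded_linear_left] bounded_op_bounded_linear)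
    show "cinner (T (scaleC c x)) y = c * cinner (T x) y" for c x
      by (simp add: bounded_op_commute_scaleC[OF assms] cinner_scaleC_left)
  qed blast
  then obtain T' where "\<And>x y. cinner (T x) y = cinner x (T' y)"
    by metis
  then show ?thesis
    using adjoint_eqI[of T T'] by simp
qed

lemma cinner_adjoint_left: "bounded_op T \<Longrightarrow> cinner (adjoint T x) y = cinner x (T y)"
  by (metis cinner_adjoint_right cinner_commute)

lemma adjoint_scaleC:
  assumes "bounded_op T"
  shows "adjoint (\<lambda>x. scaleC c (T x)) = (\<lambda>x. scaleC (cnj c) (adjoint T x))"
  by (rule adjoint_eqI) (simp add: cinner_simps cinner_adjoint_right[OF assms])

lemma self_adjoint_adjoint: "self_adjoint T \<Longrightarrow> adjoint T = T"
  by (rule adjoint_eqI) (simp add: self_adjoint_def)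

lemma bounded_op_adjoint:
  assumes "bounded_op T"
  shows "bounded_op (adjoint T)"
proof -
  note bT = bounded_op_bounded_linear[OF assms]
  have "norm (adjoint T y) \<le> onorm T * norm y" for y
  proof (cases "adjoint T y = 0")
    case False
    let ?z = "adjoint T y"
    have "(norm ?z)\<^sup>2 = Re (cinner y (T ?z))"
      by (simp add: power2_norm_eq_Re_cinner cinner_adjoint_left[OF assms])
    also have "\<dots> \<le> norm y * norm (T ?z)"
      using complex_Re_le_cmod cauchy_schwarz_cinner by (rule order_trans)
    also have "\<dots> \<le> norm y * (onorm T * norm ?z)"
      by (intro mult_left_mono onorm[OF bT]) simp
    finally show ?thesis
      using False by (simp add: power2_eq_square mult_ac)
  qed (simp add: onorm_pos_le[OF bT])
  moreover have "adjoint T (x + y) = adjoint T x + adjoint T y" for x y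
    by (rule cinner_ext) (simp add: cinner_adjoint_left[OF assms] cinner_simps)
  moreover have "adjoint T (scaleC c x) = scaleC c (adjoint T x)" for c x
    by (rule cinner_ext) (simp add: cinner_adjoint_left[OF assms] cinner_simps)
  ultimately show ?thesis
    unfolding bounded_op_def clinear_op_def by blast
qed

lemma positive_op_self_adjoint:
  assumes "positive_op Q"
  shows "self_adjoint Q"
  unfolding self_adjoint_def
proof (intro allI)
  fix x y
  have "bounded_op Q" and Im_0: "Im (cinner (Q z) z) = 0" for z
    using assms by (simp_all add: positive_op_def)
  then interpret Q: bounded_linear Q
    by (intro bounded_op_bounded_linear)
  have "Im (cinner (Q x) y) = - Im (cinner (Q y) x)"
    using Im_0[of "x + y"] Im_0[of x] Im_0[of y] by (simp add: Q.add cinner_simps)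
  moreover have "Re (cinner (Q x) y) = Re (cinner (Q y) x)"
    using Im_0[of "x + scaleC \<i> y"] Im_0[of x] Im_0[of y]
    by (simp add: Q.add bounded_op_commute_scaleC[OF \<open>bounded_op Q\<close>] cinner_simps)
  ultimately show "cinner (Q x) y = cinner x (Q y)"
    by (simp add: complex_eq_iff cinner_commute[of x "Q y"])
qed

lemma positive_op_sqrt_eigenvector:
  assumes Q: "positive_op Q" and "\<sigma> \<ge> 0" and square_eigenvector: "Q (Q e) = \<sigma>\<^sup>2 *\<^sub>R e"
  shows "Q e = \<sigma> *\<^sub>R e"
proof (cases "\<sigma> = 0")
  case True
  have "cinner (Q e) (Q e) = cinner (Q (Q e)) e"
    using positive_op_self_adjoint[OF Q] by (simp add: self_adjoint_def)
  then show ?thesis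
    using square_eigenvector True by (simp add: cinner_norm cinner_simps)
next
  case False
  interpret Q: bounded_linear Q
    using Q by (intro bounded_op_bounded_linear) (simp add: positive_op_def)
  define w where "w = Q e - \<sigma> *\<^sub>R e"
  have "Q w = - (\<sigma> *\<^sub>R w)"
    by (simp add: w_def Q.diff Q.scaleR square_eigenvector scaleR_diff_right power2_eq_square)
  then have "Re (cinner (Q w) w) = - (\<sigma> * (norm w)\<^sup>2)"
    by (simp add: cinner_simps power2_norm_eq_Re_cinner)
  moreover have "Re (cinner (Q w) w) \<ge> 0"
    using Q unfolding positive_op_def by blast
  ultimately have "\<sigma> * (norm w)\<^sup>2 \<le> 0"
    by linarith
  then have "w = 0"
    using False \<open>\<sigma> \<ge> 0\<close> by (simp add: mult_le_0_iff)
  then show ?thesis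
    by (simp add: w_def)
qed

section \<open>Compact operators\<close>

lemma compact_opI:
  assumes "clinear_op T" "compact K" "T ` cball 0 1 \<subseteq> K"
  shows "compact_op T"
proof -
  have "closure (T ` cball 0 1) \<subseteq> K"
    using assms(2,3) by (simp add: closure_minimal compact_imp_closed)
  then have "compact (K \<inter> closure (T ` cball 0 1))"
    using assms(2) by (intro compact_Int_closed) simp_all
  then show ?thesis
    using assms(1) \<open>closure (T ` cball 0 1) \<subseteq> K\<close> by (simp add: compact_op_def Int_absorb1)
qed

lemma compact_op_bounded_op:
  assumes "compact_op T"
  shows "bounded_op T"
proof -
  have linear: "clinear_op T" and "compact (closure (T ` cball 0 1))"
    using assms by (simp_all add: compact_op_def)
  then have "bounded (T ` cball 0 1)"
    using compact_imp_bounded closure_subset bounded_subset by metis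
  then obtain K where "\<forall>x\<in>cball 0 1. norm (T x) \<le> K"
    unfolding bounded_iff by auto
  then have K: "norm (T x) \<le> K" if "norm x \<le> 1" for x
    using that by simp
  have T_scaleR: "T (r *\<^sub>R x) = r *\<^sub>R T x" for r x
    using linear unfolding clinear_op_def by (metis scaleC_scaleR)
  have "norm (T x) \<le> K * norm x" for x
  proof (cases "x = 0")
    case True
    then show ?thesis
      using T_scaleR[of 0 0] by simp
  next
    case False
    then show ?thesis
      using K[of "(1 / norm x) *\<^sub>R x"] by (simp add: T_scaleR field_simps)
  qed
  then show ?thesis
    using linear unfolding bounded_op_def by blast
qed

lemma compact_op_comp_left:
  assumes "bounded_op R" "compact_op T"
  shows "compact_op (\<lambda>x. R (T x))"
proof (rule compact_opI)
  show "clinear_op (\<lambda>x. R (T x))"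
    using assms by (simp add: bounded_op_def compact_op_def clinear_op_def)
  show "compact (R ` closure (T ` cball 0 1))"
    using assms by (intro compact_continuous_image linear_continuous_on bounded_op_bounded_linear)
      (simp_all add: compact_op_def)
  show "(\<lambda>x. R (T x)) ` cball 0 1 \<subseteq> R ` closure (T ` cball 0 1)"
    using closure_subset[of "T ` cball 0 1"] by blast
qed

lemma compact_op_comp_right:
  assumes "compact_op T" "bounded_op R"
  shows "compact_op (\<lambda>x. T (R x))"
proof (rule compact_opI)
  interpret T: bounded_linear T
    using assms(1) by (intro bounded_op_bounded_linear compact_op_bounded_op)
  show "clinear_op (\<lambda>x. T (R x))"
    using assms by (simp add: bounded_op_def compact_op_def clinear_op_def)
  define k where "k = onorm R + 1"
  have "k > 0"
    using onorm_pos_le[OF bounded_op_bounded_linear[OF assms(2)]] by (simp add: k_def)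
  have R_ball: "norm (R x) \<le> k" if "norm x \<le> 1" for x
    using order_trans[OF bounded_op_norm_le[OF assms(2)] mult_left_mono[OF that]]
      onorm_pos_le[OF bounded_op_bounded_linear[OF assms(2)]] by (auto simp: k_def add_increasing2)
  show "compact ((*\<^sub>R) k ` closure (T ` cball 0 1))"
    using assms(1) by (intro compact_scaling) (simp add: compact_op_def)
  show "(\<lambda>x. T (R x)) ` cball 0 1 \<subseteq> (*\<^sub>R) k ` closure (T ` cball 0 1)"
  proof (intro image_subsetI image_eqI)
    fix x :: 'a assume "x \<in> cball 0 1"
    then show "T ((1 / k) *\<^sub>R R x) \<in> closure (T ` cball 0 1)"
      using R_ball[of x] \<open>k > 0\<close> by (intro subsetD[OF closure_subset]) auto
    show "T (R x) = k *\<^sub>R T ((1 / k) *\<^sub>R R x)"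
      using \<open>k > 0\<close> by (simp add: T.scaleR)
  qed
qed

lemma compact_op_add:
  assumes "compact_op S" "compact_op T"
  shows "compact_op (\<lambda>x. S x + T x)"
proof (rule compact_opI)
  show "clinear_op (\<lambda>x. S x + T x)"
    using assms bounded_op_add[OF assms[THEN compact_op_bounded_op]] by (simp add: bounded_op_def)
  show "compact {x + y |x y. x \<in> closure (S ` cball 0 1) \<and> y \<in> closure (T ` cball 0 1)}"
    using assms by (intro compact_sums) (simp_all add: compact_op_def)
  show "(\<lambda>x. S x + T x) ` cball 0 1
      \<subseteq> {x + y |x y. x \<in> closure (S ` cball 0 1) \<and> y \<in> closure (T ` cball 0 1)}"
    using closure_subset[of "S ` cball 0 1"] closure_subset[of "T ` cball 0 1"] by blast
qed

lemma compact_op_scaleC: "compact_op T \<Longrightarrow> compact_op (\<lambda>x. scaleC c (T x))"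
  by (rule compact_op_comp_left[OF bounded_op_scaleC])

lemma compact_closure_iff_Cauchy_subsequence:
  fixes S :: "'a::complete_space set"
  shows "compact (closure S) \<longleftrightarrow>
    (\<forall>\<sigma>::nat \<Rightarrow> 'a. range \<sigma> \<subseteq> S \<longrightarrow> (\<exists>r. strict_mono r \<and> Cauchy (\<sigma> \<circ> r)))"
proof -
  have "compact (closure S) \<longleftrightarrow> Met_TC.mtotally_bounded S"
    using Met_TC.mtotally_bounded_eq_compact_closure_of[where S=S] complete_UNIV[where 'a='a] by simp
  then show ?thesis
    unfolding Met_TC.mtotally_bounded_sequentially by simp
qed

lemma power2_dist_adjoint_le:
  assumes "bounded_op T" "norm x \<le> 1" "norm y \<le> 1"
  shows "(dist (adjoint T x) (adjoint T y))\<^sup>2 \<le> 2 * dist (T (adjoint T x)) (T (adjoint T y))"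
proof -
  interpret T: bounded_linear T
    by (rule bounded_op_bounded_linear[OF assms(1)])
  interpret adj: bounded_linear "adjoint T"
    by (rule bounded_op_bounded_linear[OF bounded_op_adjoint[OF assms(1)]])
  let ?d = "x - y"
  have "(norm (adjoint T ?d))\<^sup>2 = Re (cinner (T (adjoint T ?d)) ?d)"
    by (simp add: power2_norm_eq_Re_cinner cinner_adjoint_right[OF assms(1)])
  also have "\<dots> \<le> norm (T (adjoint T ?d)) * norm ?d"
    using complex_Re_le_cmod cauchy_schwarz_cinner by (rule order_trans)
  also have "\<dots> \<le> norm (T (adjoint T ?d)) * 2"
    using assms(2,3) norm_triangle_ineq4[of x y] by (intro mult_left_mono) auto
  finally show ?thesis
    by (simp add: dist_norm adj.diff T.diff)
qed

lemma Cauchy_power2_dist_le: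
  fixes X :: "nat \<Rightarrow> 'a::metric_space" and Y :: "nat \<Rightarrow> 'b::metric_space"
  assumes "Cauchy Y" "C > 0" and dist_le: "\<And>m n. (dist (X m) (X n))\<^sup>2 \<le> C * dist (Y m) (Y n)"
  shows "Cauchy X"
proof (rule metric_CauchyI)
  fix \<epsilon> :: real assume "\<epsilon> > 0"
  then obtain N where N: "\<And>m n. m \<ge> N \<Longrightarrow> n \<ge> N \<Longrightarrow> dist (Y m) (Y n) < \<epsilon>\<^sup>2 / C"
    using metric_CauchyD[OF \<open>Cauchy Y\<close>, of "\<epsilon>\<^sup>2 / C"] \<open>C > 0\<close> by auto
  have "dist (X m) (X n) < \<epsilon>" if "m \<ge> N" "n \<ge> N" for m n
  proof (rule power_less_imp_less_base)
    show "(dist (X m) (X n))\<^sup>2 < \<epsilon>\<^sup>2"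
      using dist_le[of m n] N[OF that] \<open>C > 0\<close> by (simp add: field_simps)
  qed (use \<open>\<epsilon> > 0\<close> in simp)
  then show "\<exists>N. \<forall>m\<ge>N. \<forall>n\<ge>N. dist (X m) (X n) < \<epsilon>"
    by blast
qed

theorem compact_op_adjoint:
  fixes T :: "'a::chilbert \<Rightarrow> 'a"
  assumes "compact_op T"
  shows "compact_op (adjoint T)"
proof -
  note bounded = compact_op_bounded_op[OF assms]
  have T_adjoint_compact: "compact (closure ((\<lambda>x. T (adjoint T x)) ` cball 0 1))"
    using compact_op_comp_right[OF assms bounded_op_adjoint[OF bounded]] by (simp add: compact_op_def)
  have "\<exists>r. strict_mono r \<and> Cauchy (\<sigma> \<circ> r)"
    if "range \<sigma> \<subseteq> adjoint T ` cball 0 1" for \<sigma> :: "nat \<Rightarrow> 'a"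
  proof -
    have "\<forall>n. \<exists>y. \<sigma> n = adjoint T y \<and> norm y \<le> 1"
      using that by fastforce
    then obtain y where y: "\<And>n. \<sigma> n = adjoint T (y n)" "\<And>n. norm (y n) \<le> 1"
      by metis
    then have "range (\<lambda>n. T (\<sigma> n)) \<subseteq> (\<lambda>x. T (adjoint T x)) ` cball 0 1"
      by fastforce
    then obtain r where r: "strict_mono r" and "Cauchy ((\<lambda>n. T (\<sigma> n)) \<circ> r)"
      using T_adjoint_compact unfolding compact_closure_iff_Cauchy_subsequence by blast
    then have "Cauchy (\<sigma> \<circ> r)"
      using power2_dist_adjoint_le[OF bounded y(2) y(2)]
      by (elim Cauchy_power2_dist_le[where C=2]) (simp_all add: y(1))
    with r show ?thesis
      by blast
  qed
  then have "compact (closure (adjoint T ` cball 0 1))"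
    by (simp add: compact_closure_iff_Cauchy_subsequence)
  then show ?thesis
    using bounded_op_adjoint[OF bounded] by (simp add: compact_op_def bounded_op_def)
qed

section \<open>Spectral theorem for compact self-adjoint operators\<close>

lemma self_adjoint_square_eigenvector_defect:
  assumes "self_adjoint A" and bound: "\<And>x. x \<in> M \<Longrightarrow> norm (A x) \<le> m * norm x"
    and "x \<in> M" "A x \<in> M"
  shows "(norm (A (A x) - m\<^sup>2 *\<^sub>R x))\<^sup>2 \<le> m\<^sup>2 * ((m * norm x)\<^sup>2 - (norm (A x))\<^sup>2)"
proof -
  have "cinner (A (A x)) x = cinner (A x) (A x)"
    using assms(1) by (simp add: self_adjoint_def)
  then have "(norm (A (A x) - m\<^sup>2 *\<^sub>R x))\<^sup>2
      = (norm (A (A x)))\<^sup>2 + (m\<^sup>2 * norm x)\<^sup>2 - 2 * m\<^sup>2 * (norm (A x))\<^sup>2"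
    by (simp add: power2_norm_diff cinner_simps cinner_norm)
  moreover have "(norm (A (A x)))\<^sup>2 \<le> (m * norm (A x))\<^sup>2"
    using bound[OF assms(4)] by (intro power_mono) auto
  ultimately show ?thesis
    by (simp add: algebra_simps power2_eq_square)
qed

lemma self_adjoint_power2_norm_le:
  assumes "self_adjoint A" "y \<in> closure (A ` cball 0 1)"
  shows "(norm y)\<^sup>2 \<le> norm (A y)"
proof -
  have "cmod (cinner y z) \<le> norm (A y)" if "z \<in> A ` cball 0 1" for z
  proof -
    obtain x where x: "z = A x" "norm x \<le> 1"
      using \<open>z \<in> A ` cball 0 1\<close> by auto
    have "cmod (cinner y z) = cmod (cinner (A y) x)"
      using assms(1) by (simp add: x(1) self_adjoint_def)
    also have "\<dots> \<le> norm (A y) * norm x"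
      by (rule cauchy_schwarz_cinner)
    also have "\<dots> \<le> norm (A y)"
      using x(2) by (simp add: mult_left_le)
    finally show ?thesis .
  qed
  moreover have "closed {z. cmod (cinner y z) \<le> norm (A y)}"
    by (intro closed_Collect_le continuous_intros linear_continuous_on cinner.bounded_linear_right)
  ultimately have "closure (A ` cball 0 1) \<subseteq> {z. cmod (cinner y z) \<le> norm (A y)}"
    by (intro closure_minimal) auto
  then show ?thesis
    using assms(2) by (auto simp: cinner_norm norm_power)
qed

lemma compact_op_norm_maximizer:
  fixes A :: "'a::chilbert \<Rightarrow> 'a"
  assumes A: "compact_op A" and "subspace M"
  obtains y where "y \<in> closure (A ` (M \<inter> cball 0 1))" "\<And>x. x \<in> M \<Longrightarrow> norm (A x) \<le> norm y * norm x"
proof -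
  interpret A: bounded_linear A
    by (rule bounded_op_bounded_linear[OF compact_op_bounded_op[OF A]])
  define K where "K = closure (A ` (M \<inter> cball 0 1))"
  have image_K: "A x \<in> K" if "x \<in> M" "norm x \<le> 1" for x
    using that closure_subset unfolding K_def by fastforce
  have "K \<subseteq> closure (A ` cball 0 1)"
    unfolding K_def by (intro closure_mono) auto
  then have "compact K"
    using A compact_Int_closed[of "closure (A ` cball 0 1)" K]
    by (simp add: compact_op_def Int_absorb1 K_def)
  moreover have "K \<noteq> {}"
    using image_K[OF subspace_0[OF \<open>subspace M\<close>]] by auto
  ultimately obtain y where y: "y \<in> K" and maximal: "\<And>z. z \<in> K \<Longrightarrow> norm z \<le> norm y"
    using continuous_attains_sup[of K norm] continuous_on_norm_id by blast
  have "norm (A x) \<le> norm y * norm x" if "x \<in> M" for x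
  proof (cases "x = 0")
    case False
    have "norm (A ((1 / norm x) *\<^sub>R x)) \<le> norm y"
      using that False \<open>subspace M\<close> by (intro maximal image_K) (simp_all add: subspace_scale)
    then show ?thesis
      using False by (simp add: A.scaleR field_simps)
  qed (simp add: A.zero)
  with y show thesis
    unfolding K_def by (rule that)
qed

text \<open>The vector \<open>y\<close> maximises the norm on the closed image of the unit ball of \<open>M\<close>.\<close>
lemma compact_self_adjoint_square_eigenvector:
  fixes A :: "'a::chilbert \<Rightarrow> 'a"
  assumes A: "compact_op A" "self_adjoint A"
    and M: "closed M" "subspace M" and invariant: "\<And>x. x \<in> M \<Longrightarrow> A x \<in> M"
  obtains y where "y \<in> M" "\<And>x. x \<in> M \<Longrightarrow> norm (A x) \<le> norm y * norm x" "A (A y) = (norm y)\<^sup>2 *\<^sub>R y"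
proof -
  obtain y where y: "y \<in> closure (A ` (M \<inter> cball 0 1))"
    and bound: "\<And>x. x \<in> M \<Longrightarrow> norm (A x) \<le> norm y * norm x"
    using compact_op_norm_maximizer[OF A(1) M(2)] by blast
  have "closure (A ` (M \<inter> cball 0 1)) \<subseteq> M"
    using invariant M(1) by (intro closure_minimal) auto
  with y have "y \<in> M"
    by blast
  have "(norm y)\<^sup>2 \<le> norm (A y)"
    using y closure_mono[of "A ` (M \<inter> cball 0 1)" "A ` cball 0 1"]
    by (intro self_adjoint_power2_norm_le A(2)) auto
  have "(norm (A (A y) - (norm y)\<^sup>2 *\<^sub>R y))\<^sup>2 \<le> (norm y)\<^sup>2 * ((norm y * norm y)\<^sup>2 - (norm (A y))\<^sup>2)"
    using \<open>y \<in> M\<close> invariant by (intro self_adjoint_square_eigenvector_defect[OF A(2) bound]) auto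
  also have "\<dots> \<le> 0"
    using power_mono[OF \<open>(norm y)\<^sup>2 \<le> norm (A y)\<close>, of 2]
    by (intro mult_nonneg_nonpos) (simp_all add: power2_eq_square)
  finally have "A (A y) = (norm y)\<^sup>2 *\<^sub>R y"
    by simp
  with \<open>y \<in> M\<close> bound show thesis
    by (rule that)
qed

lemma compact_self_adjoint_eigenvector_exists:
  fixes A :: "'a::chilbert \<Rightarrow> 'a"
  assumes A: "compact_op A" "self_adjoint A"
    and M: "closed M" "subspace M" and invariant: "\<And>x. x \<in> M \<Longrightarrow> A x \<in> M"
    and z: "z \<in> M" "z \<noteq> 0"
  shows "\<exists>e\<in>M. norm e = 1 \<and> (\<exists>\<alpha>. A e = \<alpha> *\<^sub>R e)"
proof -
  interpret A: bounded_linear A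
    by (rule bounded_op_bounded_linear[OF compact_op_bounded_op[OF A(1)]])
  have normalize: ?thesis if "w \<in> M" "w \<noteq> 0" "A w = \<alpha> *\<^sub>R w" for w \<alpha>
  proof (intro bexI[of _ "sgn w"] conjI exI)
    show "sgn w \<in> M" "norm (sgn w) = 1" "A (sgn w) = \<alpha> *\<^sub>R sgn w"
      using that M(2) by (simp_all add: sgn_div_norm subspace_scale A.scaleR)
  qed
  obtain y where y: "y \<in> M" "\<And>x. x \<in> M \<Longrightarrow> norm (A x) \<le> norm y * norm x" "A (A y) = (norm y)\<^sup>2 *\<^sub>R y"
    using compact_self_adjoint_square_eigenvector[OF A M invariant] by blast
  define w where "w = A y + norm y *\<^sub>R y"
  have "w \<in> M"
    unfolding w_def using y(1) M(2) invariant by (simp add: subspace_add subspace_scale)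
  have eigenvector_w: "A w = norm y *\<^sub>R w"
    by (simp add: w_def A.add A.scaleR y(3) scaleR_add_right power2_eq_square)
  consider (zero) "y = 0" | (negative) "w = 0" "y \<noteq> 0" | (positive) "w \<noteq> 0"
    by blast
  then show ?thesis
  proof cases
    case zero
    then show ?thesis
      using normalize[OF z, of 0] y(2)[OF z(1)] by simp
  next
    case negative
    then show ?thesis
      using normalize[OF y(1), of "- norm y"] by (simp add: w_def eq_neg_iff_add_eq_0)
  next
    case positive
    then show ?thesis
      using normalize[OF \<open>w \<in> M\<close> _ eigenvector_w] by blast
  qed
qed

theorem compact_self_adjoint_eigenbasis:
  fixes A :: "'a::chilbert \<Rightarrow> 'a"
  assumes A: "compact_op A" "self_adjoint A"
  obtains E \<alpha> where "onb E" "\<And>e. e \<in> E \<Longrightarrow> A e = \<alpha> e *\<^sub>R e"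
proof -
  define V where "V = {e. \<exists>\<alpha>. A e = \<alpha> *\<^sub>R e}"
  obtain E where E: "E \<subseteq> V" "orthonormal E"
    and maximal: "\<And>e. e \<in> V \<Longrightarrow> norm e = 1 \<Longrightarrow> e \<notin> orthogonal_complement E"
    using maximal_orthonormal_subset_exists[of V] by blast
  have "\<forall>e\<in>E. \<exists>\<alpha>. A e = \<alpha> *\<^sub>R e"
    using E(1) by (auto simp: V_def)
  then obtain \<alpha> where \<alpha>: "\<And>e. e \<in> E \<Longrightarrow> A e = \<alpha> e *\<^sub>R e"
    by metis
  have invariant: "A x \<in> orthogonal_complement E" if "x \<in> orthogonal_complement E" for x
    using that A(2) by (simp add: orthogonal_complement_def self_adjoint_def \<alpha> cinner_simps)
  have "x = 0" if x: "x \<in> orthogonal_complement E" for x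
  proof (rule ccontr)
    assume "x \<noteq> 0"
    then obtain e \<alpha> where "e \<in> orthogonal_complement E" "norm e = 1" "A e = \<alpha> *\<^sub>R e"
      using compact_self_adjoint_eigenvector_exists[OF A closed_orthogonal_complement
          subspace_orthogonal_complement invariant x] by blast
    then show False
      using maximal[of e] by (auto simp: V_def)
  qed
  then have "onb E"
    using E(2) by (auto simp: onb_iff_orthogonal_complement)
  then show thesis
    using \<alpha> by (rule that)
qed

section \<open>Infinite sums of extended nonnegative reals\<close>

lemma ennreal_summable_on [simp]: "(f :: 'i \<Rightarrow> ennreal) summable_on A"
  by (rule nonneg_summable_on_complete) simp

lemma finite_sum_le_infsum_ennreal:
  fixes f :: "'i \<Rightarrow> ennreal"
  assumes "finite F" "F \<subseteq> A"
  shows "sum f F \<le> infsum f A"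
  by (subst nonneg_infsum_complete) (use assms in \<open>auto intro: SUP_upper\<close>)

lemma infsum_mono_subset_ennreal:
  fixes f :: "'i \<Rightarrow> ennreal"
  assumes "A \<subseteq> B"
  shows "infsum f A \<le> infsum f B"
  using assms by (intro infsum_mono_neutral) auto

lemma infsum_cmult_ennreal:
  fixes f :: "'i \<Rightarrow> ennreal"
  shows "(\<Sum>\<^sub>\<infinity>i\<in>A. c * f i) = c * infsum f A"
  by (simp add: nonneg_infsum_complete SUP_mult_left_ennreal flip: sum_distrib_left)

lemma sum_infsum_swap_ennreal:
  fixes f :: "'i \<Rightarrow> 'j \<Rightarrow> ennreal"
  shows "(\<Sum>i\<in>F. \<Sum>\<^sub>\<infinity>j\<in>A. f i j) = (\<Sum>\<^sub>\<infinity>j\<in>A. \<Sum>i\<in>F. f i j)"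
  by (induction F rule: infinite_finite_induct) (simp_all add: infsum_add)

lemma infsum_fibres_ennreal:
  fixes f :: "'i \<Rightarrow> ennreal"
  shows "infsum f A = (\<Sum>\<^sub>\<infinity>y\<in>h ` A. infsum f {x \<in> A. h x = y})"
proof (rule antisym)
  show "infsum f A \<le> (\<Sum>\<^sub>\<infinity>y\<in>h ` A. infsum f {x \<in> A. h x = y})"
  proof (rule infsum_le_finite_sums)
    fix F assume F: "finite F" "F \<subseteq> A"
    have "sum f F = (\<Sum>y\<in>h ` F. sum f {x \<in> F. h x = y})"
      by (rule sum.image_gen[OF F(1)])
    also have "\<dots> \<le> (\<Sum>y\<in>h ` F. infsum f {x \<in> A. h x = y})"
      using F by (intro sum_mono finite_sum_le_infsum_ennreal) auto
    also have "\<dots> \<le> (\<Sum>\<^sub>\<infinity>y\<in>h ` A. infsum f {x \<in> A. h x = y})"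
      using F by (intro finite_sum_le_infsum_ennreal) auto
    finally show "sum f F \<le> \<dots>" .
  qed simp
  show "(\<Sum>\<^sub>\<infinity>y\<in>h ` A. infsum f {x \<in> A. h x = y}) \<le> infsum f A"
  proof (rule infsum_le_finite_sums)
    fix Y assume "finite Y" "Y \<subseteq> h ` A"
    then have "(\<Sum>y\<in>Y. infsum f {x \<in> A. h x = y}) = infsum f (\<Union>y\<in>Y. {x \<in> A. h x = y})"
      by (intro sum_infsum) auto
    also have "\<dots> \<le> infsum f A"
      by (intro infsum_mono_subset_ennreal) auto
    finally show "(\<Sum>y\<in>Y. infsum f {x \<in> A. h x = y}) \<le> infsum f A" .
  qed simp
qed

lemma infsum_ennreal:
  assumes "f summable_on A" "\<And>x. x \<in> A \<Longrightarrow> 0 \<le> f x"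
  shows "(\<Sum>\<^sub>\<infinity>x\<in>A. ennreal (f x)) = ennreal (infsum f A)"
proof -
  have "(\<Sum>\<^sub>\<infinity>x\<in>A. ennreal (f x)) = (SUP F\<in>{F. finite F \<and> F \<subseteq> A}. \<Sum>x\<in>F. ennreal (f x))"
    by (rule nonneg_infsum_complete) simp
  also have "\<dots> = (SUP F\<in>{F. finite F \<and> F \<subseteq> A}. ennreal (sum f F))"
    using assms(2) by (intro SUP_cong) (auto intro!: sum_ennreal)
  also have "\<dots> = ennreal (infsum f A)"
    using infsum_nonneg_is_SUPREMUM_ennreal[OF assms] by simp
  finally show ?thesis .
qed

lemma summable_on_iff_infsum_ennreal_less_top:
  assumes "\<And>x. x \<in> A \<Longrightarrow> 0 \<le> f x"
  shows "f summable_on A \<longleftrightarrow> (\<Sum>\<^sub>\<infinity>x\<in>A. ennreal (f x)) < top"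
proof
  show "(\<Sum>\<^sub>\<infinity>x\<in>A. ennreal (f x)) < top" if "f summable_on A"
    using infsum_ennreal[OF that assms] by simp
next
  assume "(\<Sum>\<^sub>\<infinity>x\<in>A. ennreal (f x)) < top"
  then obtain M where M: "(\<Sum>\<^sub>\<infinity>x\<in>A. ennreal (f x)) = ennreal M" "M \<ge> 0"
    by (cases rule: ennreal_cases[of "\<Sum>\<^sub>\<infinity>x\<in>A. ennreal (f x)"]) auto
  have "sum f F \<le> M" if F: "finite F" "F \<subseteq> A" for F
  proof -
    have "ennreal (sum f F) = (\<Sum>x\<in>F. ennreal (f x))"
      using F assms by (intro sum_ennreal[symmetric]) auto
    also have "\<dots> \<le> ennreal M"
      unfolding M(1)[symmetric] by (rule finite_sum_le_infsum_ennreal[OF F])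
    finally show ?thesis
      using M(2) by (simp add: ennreal_le_iff)
  qed
  then show "f summable_on A"
    using assms by (intro nonneg_bdd_above_summable_on bdd_aboveI2[where M=M]) auto
qed

lemma sum_ennreal_mult_le:
  assumes "sum w F \<le> C" "\<And>i. i \<in> F \<Longrightarrow> 0 \<le> w i" "0 \<le> a"
  shows "(\<Sum>i\<in>F. ennreal (a * w i)) \<le> ennreal C * ennreal a"
proof -
  have "(\<Sum>i\<in>F. ennreal (a * w i)) = ennreal (a * sum w F)"
    unfolding sum_distrib_left using assms(2,3) by (intro sum_ennreal) simp
  also have "\<dots> \<le> ennreal (C * a)"
    unfolding mult.commute[of C] using assms(1,3) by (intro ennreal_leI mult_left_mono)
  finally show ?thesis
    using order_trans[OF sum_nonneg assms(1)] assms(2,3) by (simp add: ennreal_mult)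
qed

lemma suminf_eq_infsum_ennreal: "(\<Sum>n. f n :: ennreal) = infsum f UNIV"
  using has_sum_imp_sums[OF has_sum_infsum[OF ennreal_summable_on]] by (rule sums_unique[symmetric])

section \<open>The modulus and the singular values\<close>

lemma positive_op_sqrt_unique:
  assumes E: "onb E" and Q: "positive_op Q" and R: "positive_op R" and QR: "\<And>x. Q (Q x) = R (R x)"
    and eigen: "\<And>e. e \<in> E \<Longrightarrow> \<sigma> e \<ge> 0 \<and> R (R e) = (\<sigma> e)\<^sup>2 *\<^sub>R e"
  shows "Q = R"
proof (rule bounded_op_eq_on_onb[OF E])
  show "bounded_op Q" "bounded_op R"
    using Q R by (simp_all add: positive_op_def)
  show "Q e = R e" if "e \<in> E" for e
    using positive_op_sqrt_eigenvector[OF Q, of "\<sigma> e"] positive_op_sqrt_eigenvector[OF R, of "\<sigma> e"]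
      eigen[OF that] QR by simp
qed

lemma diagonal_op_exists:
  fixes E :: "'a::chilbert set" and c :: "'a \<Rightarrow> complex"
  assumes E: "onb E" and c_bounded: "\<And>e. e \<in> E \<Longrightarrow> cmod (c e) \<le> K"
  shows "\<exists>R. bounded_op R \<and> (\<forall>x. \<forall>e\<in>E. cinner (R x) e = c e * cinner x e)"
proof -
  have coefficient_le: "(cmod (c e * cinner x e))\<^sup>2 \<le> K\<^sup>2 * (cmod (cinner x e))\<^sup>2" if "e \<in> E" for x e
    unfolding norm_mult power_mult_distrib using c_bounded[OF that]
    by (intro mult_right_mono power_mono) auto
  have "(\<lambda>e. (cmod (c e * cinner x e))\<^sup>2) summable_on E" for x
    using summable_on_cmult_right[OF onb_summable[OF E]] coefficient_le
    by (rule summable_on_comparison_test) simp_all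
  then have "\<exists>z. \<forall>e\<in>E. cinner z e = c e * cinner x e" for x
    using riesz_fischer[OF onb_orthonormal[OF E], of "\<lambda>e. c e * cinner x e"] by metis
  then obtain R where R: "\<And>x e. e \<in> E \<Longrightarrow> cinner (R x) e = c e * cinner x e"
    by metis
  have "norm (R x) \<le> \<bar>K\<bar> * norm x" for x
  proof (rule power2_le_imp_le)
    have "(norm (R x))\<^sup>2 \<le> K\<^sup>2 * (norm x)\<^sup>2"
      using coefficient_le R
      by (intro has_sum_mono[OF parseval_norm[OF E] has_sum_cmult_right[OF parseval_norm[OF E]]]) simp
    then show "(norm (R x))\<^sup>2 \<le> (\<bar>K\<bar> * norm x)\<^sup>2"
      by (simp add: power_mult_distrib)
  qed simp
  moreover have "R (x + y) = R x + R y" for x y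
    by (rule onb_eqI[OF E]) (simp add: R cinner_simps algebra_simps)
  moreover have "R (scaleC a x) = scaleC a (R x)" for a x
    by (rule onb_eqI[OF E]) (simp add: R cinner_simps)
  ultimately have "bounded_op R"
    unfolding bounded_op_def clinear_op_def by blast
  with R show ?thesis
    by blast
qed

lemma diagonal_op_positive:
  assumes E: "onb E" and "bounded_op R"
    and R: "\<And>x e. e \<in> E \<Longrightarrow> cinner (R x) e = complex_of_real (c e) * cinner x e"
    and c_nonneg: "\<And>e. e \<in> E \<Longrightarrow> 0 \<le> c e"
  shows "positive_op R"
proof -
  have "Im (cinner (R x) x) = 0 \<and> Re (cinner (R x) x) \<ge> 0" for x
  proof -
    have "cinner (R x) e * cinner e x = complex_of_real (c e * (cmod (cinner x e))\<^sup>2)" if "e \<in> E" for e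
      using cinner_commute[of e x] by (simp add: R[OF that] complex_norm_square del: of_real_power)
    then have form: "((\<lambda>e. complex_of_real (c e * (cmod (cinner x e))\<^sup>2)) has_sum cinner (R x) x) E"
      using parseval[OF E, of "R x" x] by (simp cong: has_sum_cong)
    have "((\<lambda>e. 0) has_sum Im (cinner (R x) x)) E"
      using has_sum_Im[OF form] by simp
    then have "Im (cinner (R x) x) = 0"
      using has_sum_0_simp has_sum_unique by blast
    moreover have "Re (cinner (R x) x) \<ge> 0"
      using has_sum_Re[OF form] by (rule has_sum_nonneg) (use c_nonneg in simp)
    ultimately show ?thesis
      by simp
  qed
  then show ?thesis
    using \<open>bounded_op R\<close> by (simp add: positive_op_def)
qed

definition right_singular_basis :: "('a::chilbert \<Rightarrow> 'a) \<Rightarrow> 'a set \<Rightarrow> bool" where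
  "right_singular_basis S E \<longleftrightarrow> onb E \<and> (\<forall>e\<in>E. adjoint S (S e) = (norm (S e))\<^sup>2 *\<^sub>R e)"

lemma right_singular_basis_onb: "right_singular_basis S E \<Longrightarrow> onb E"
  by (simp add: right_singular_basis_def)

lemma right_singular_basis_exists:
  fixes S :: "'a::chilbert \<Rightarrow> 'a"
  assumes "compact_op S"
  obtains E where "right_singular_basis S E"
proof -
  note bounded = compact_op_bounded_op[OF assms]
  have "compact_op (\<lambda>x. adjoint S (S x))"
    by (rule compact_op_comp_left[OF bounded_op_adjoint[OF bounded] assms])
  moreover have "self_adjoint (\<lambda>x. adjoint S (S x))"
    by (simp add: self_adjoint_def cinner_adjoint_left[OF bounded] cinner_adjoint_right[OF bounded])
  ultimately obtain E \<beta> where E: "onb E" and \<beta>: "\<And>e. e \<in> E \<Longrightarrow> adjoint S (S e) = \<beta> e *\<^sub>R e"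
    using compact_self_adjoint_eigenbasis by blast
  have "\<beta> e = (norm (S e))\<^sup>2" if "e \<in> E" for e
  proof -
    have "(norm (S e))\<^sup>2 = Re (cinner (adjoint S (S e)) e)"
      by (simp add: cinner_adjoint_left[OF bounded] power2_norm_eq_Re_cinner)
    also have "\<dots> = \<beta> e"
      using orthonormal_cinner[OF onb_orthonormal[OF E] that that] by (simp add: \<beta>[OF that] cinner_simps)
    finally show ?thesis
      by simp
  qed
  with E \<beta> have "right_singular_basis S E"
    by (simp add: right_singular_basis_def)
  then show thesis
    by (rule that)
qed

lemma cinner_abs_op:
  assumes bounded: "bounded_op S" and E: "right_singular_basis S E" and "e \<in> E"
  shows "cinner (abs_op S x) e = complex_of_real (norm (S e)) * cinner x e"
proof -
  note onb = right_singular_basis_onb[OF E]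
  have "norm (S e) \<le> onorm S" if "e \<in> E" for e
    using bounded_op_norm_le[OF bounded, of e] orthonormal_norm[OF onb_orthonormal[OF onb] that] by simp
  then obtain R where "bounded_op R"
    and R: "\<And>x e. e \<in> E \<Longrightarrow> cinner (R x) e = complex_of_real (norm (S e)) * cinner x e"
    using diagonal_op_exists[OF onb, of "\<lambda>e. complex_of_real (norm (S e))" "onorm S"] by auto
  then have "positive_op R"
    by (intro diagonal_op_positive[OF onb]) auto
  have square: "R (R x) = adjoint S (S x)" for x
  proof (rule onb_eqI[OF onb])
    fix e assume e: "e \<in> E"
    have "cinner (adjoint S (S x)) e = cinner x (adjoint S (S e))"
      by (simp add: cinner_adjoint_left[OF bounded] cinner_adjoint_right[OF bounded])
    then show "cinner (R (R x)) e = cinner (adjoint S (S x)) e"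
      using E e
      by (simp add: R[OF e] right_singular_basis_def cinner_simps power2_eq_square scaleR_conv_of_real)
  qed
  have "abs_op S = R"
    unfolding abs_op_def
  proof (rule the_equality)
    show "positive_op R \<and> (\<forall>x. R (R x) = adjoint S (S x))"
      using \<open>positive_op R\<close> square by blast
    show "Q = R" if "positive_op Q \<and> (\<forall>x. Q (Q x) = adjoint S (S x))" for Q
      using that \<open>positive_op R\<close> square E
      by (intro positive_op_sqrt_unique[OF onb, where \<sigma>="\<lambda>e. norm (S e)"])
        (simp_all add: right_singular_basis_def)
  qed
  then show ?thesis
    using R[OF \<open>e \<in> E\<close>] by simp
qed

lemma eigenspace_abs_op:
  assumes bounded: "bounded_op S" and E: "right_singular_basis S E"
  shows "eigenspace (abs_op S) (complex_of_real s) = orthogonal_complement (E - {e \<in> E. norm (S e) = s})"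
proof -
  note onb = right_singular_basis_onb[OF E]
  have "abs_op S x = scaleC (complex_of_real s) x \<longleftrightarrow>
      (\<forall>e\<in>E - {e \<in> E. norm (S e) = s}. cinner x e = 0)" for x
  proof -
    have "abs_op S x = scaleC (complex_of_real s) x \<longleftrightarrow>
        (\<forall>e\<in>E. cinner (abs_op S x) e = cinner (scaleC (complex_of_real s) x) e)"
      using onb_eqI[OF onb, of "abs_op S x" "scaleC (complex_of_real s) x"] by auto
    also have "\<dots> \<longleftrightarrow> (\<forall>e\<in>E - {e \<in> E. norm (S e) = s}. cinner x e = 0)"
      by (auto simp: cinner_abs_op[OF bounded E] cinner_simps)
    finally show ?thesis .
  qed
  then show ?thesis
    by (simp add: eigenspace_def orthogonal_complement_def)
qed

lemma singular_value_set_eq: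
  assumes bounded: "bounded_op S" and E: "right_singular_basis S E"
  shows "singular_value_set S = (\<lambda>e. norm (S e)) ` {e \<in> E. S e \<noteq> 0}"
proof -
  note onb = right_singular_basis_onb[OF E]
  have "orthogonal_complement (E - {e \<in> E. norm (S e) = s}) \<noteq> {0} \<longleftrightarrow> (\<exists>e\<in>E. norm (S e) = s)"
    (is "?V \<noteq> {0} \<longleftrightarrow> _") for s
  proof
    assume "?V \<noteq> {0}"
    then have "\<not> ?V \<subseteq> {0}"
      using subspace_0[OF subspace_orthogonal_complement] by auto
    then have "{e \<in> E. norm (S e) = s} \<noteq> {}"
      using onb unfolding onb_iff_orthogonal_complement by (metis Diff_empty)
    then show "\<exists>e\<in>E. norm (S e) = s"
      by blast
  next
    assume "\<exists>e\<in>E. norm (S e) = s"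
    then obtain e where e: "e \<in> E" "norm (S e) = s"
      by blast
    then have "e \<in> ?V"
      using orthonormal_cinner[OF onb_orthonormal[OF onb]] by (auto simp: orthogonal_complement_def)
    moreover have "e \<noteq> 0"
      using orthonormal_norm[OF onb_orthonormal[OF onb] e(1)] by auto
    ultimately show "?V \<noteq> {0}"
      by blast
  qed
  then show ?thesis
    unfolding singular_value_set_def eigenspace_abs_op[OF bounded E] by force
qed

lemma card_orthonormal_le_infsum:
  fixes E :: "'a::chilbert set"
  assumes E: "onb E" and F: "F \<subseteq> E"
    and B: "finite B" "orthonormal B" "B \<subseteq> orthogonal_complement (E - F)"
  shows "of_nat (card B) \<le> (\<Sum>\<^sub>\<infinity>e\<in>F. 1::ennreal)"
proof -
  have "(\<Sum>\<^sub>\<infinity>e\<in>F. ennreal ((cmod (cinner b e))\<^sup>2)) = 1" if "b \<in> B" for b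
  proof -
    have "((\<lambda>e. (cmod (cinner b e))\<^sup>2) has_sum 1) F"
      using parseval_norm_subset[OF E F, of b] orthonormal_norm[OF B(2) that] B(3) that by auto
    then show ?thesis
      using infsum_ennreal[of "\<lambda>e. (cmod (cinner b e))\<^sup>2" F]
      by (simp add: has_sum_imp_summable infsumI)
  qed
  then have "of_nat (card B) = (\<Sum>b\<in>B. \<Sum>\<^sub>\<infinity>e\<in>F. ennreal ((cmod (cinner b e))\<^sup>2))"
    by simp
  also have "\<dots> = (\<Sum>\<^sub>\<infinity>e\<in>F. ennreal (\<Sum>b\<in>B. (cmod (cinner e b))\<^sup>2))"
    by (simp add: sum_infsum_swap_ennreal cmod_cinner_commute)
  also have "\<dots> \<le> (\<Sum>\<^sub>\<infinity>e\<in>F. 1)"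
  proof (intro infsum_mono)
    fix e assume "e \<in> F"
    then have "norm e = 1"
      using orthonormal_norm[OF onb_orthonormal[OF E]] F by blast
    then have "(\<Sum>b\<in>B. (cmod (cinner e b))\<^sup>2) \<le> 1"
      using bessel_onD[OF bessel_on_orthonormal[OF B(2)] B(1) subset_refl, of e] by simp
    then show "ennreal (\<Sum>b\<in>B. (cmod (cinner e b))\<^sup>2) \<le> 1"
      by simp
  qed simp_all
  finally show ?thesis .
qed

lemma hdim_orthogonal_complement:
  fixes E :: "'a::chilbert set"
  assumes E: "onb E" and F: "F \<subseteq> E"
  shows "hdim (orthogonal_complement (E - F)) = (\<Sum>\<^sub>\<infinity>e\<in>F. 1)" (is "hdim ?V = _")
proof (rule antisym)
  have orthonormal: "orthonormal F"
    using onb_orthonormal[OF E] F by (rule orthonormal_subset)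
  show "hdim ?V \<le> (\<Sum>\<^sub>\<infinity>e\<in>F. 1)"
    unfolding hdim_def using card_orthonormal_le_infsum[OF E F] by (intro SUP_least) auto
  have "F \<subseteq> ?V"
    using F orthonormal_cinner[OF onb_orthonormal[OF E]] by (auto simp: orthogonal_complement_def)
  then have "(\<Sum>e\<in>B. 1) \<le> hdim ?V" if "finite B" "B \<subseteq> F" for B
    using that orthonormal_subset[OF orthonormal] unfolding hdim_def by (intro SUP_upper2[of B]) auto
  then show "(\<Sum>\<^sub>\<infinity>e\<in>F. 1) \<le> hdim ?V"
    by (intro infsum_le_finite_sums) auto
qed

theorem schatten_pow_eq_infsum:
  fixes S :: "'a::chilbert \<Rightarrow> 'a"
  assumes bounded: "bounded_op S" and E: "right_singular_basis S E"
  shows "schatten_pow p S = (\<Sum>\<^sub>\<infinity>e\<in>E. ennreal (norm (S e) powr p))"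
proof -
  define E' where "E' = {e \<in> E. S e \<noteq> 0}"
  have "hdim (eigenspace (abs_op S) (complex_of_real s)) * ennreal (s powr p)
      = (\<Sum>\<^sub>\<infinity>e\<in>{e \<in> E'. norm (S e) = s}. ennreal (norm (S e) powr p))"
    if "s \<in> (\<lambda>e. norm (S e)) ` E'" for s
  proof -
    have "hdim (eigenspace (abs_op S) (complex_of_real s)) = (\<Sum>\<^sub>\<infinity>e\<in>{e \<in> E. norm (S e) = s}. 1)"
      unfolding eigenspace_abs_op[OF bounded E]
      by (intro hdim_orthogonal_complement right_singular_basis_onb[OF E]) auto
    also have "{e \<in> E. norm (S e) = s} = {e \<in> E'. norm (S e) = s}"
      using that by (auto simp: E'_def)
    finally have "hdim (eigenspace (abs_op S) (complex_of_real s)) * ennreal (s powr p)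
        = ennreal (s powr p) * (\<Sum>\<^sub>\<infinity>e\<in>{e \<in> E'. norm (S e) = s}. 1)"
      by (simp only: mult.commute)
    also have "\<dots> = (\<Sum>\<^sub>\<infinity>e\<in>{e \<in> E'. norm (S e) = s}. ennreal (s powr p) * 1)"
      by (rule infsum_cmult_ennreal[symmetric])
    also have "\<dots> = (\<Sum>\<^sub>\<infinity>e\<in>{e \<in> E'. norm (S e) = s}. ennreal (norm (S e) powr p))"
      by (intro infsum_cong) auto
    finally show ?thesis .
  qed
  then have "schatten_pow p S = (\<Sum>\<^sub>\<infinity>s\<in>(\<lambda>e. norm (S e)) ` E'.
      \<Sum>\<^sub>\<infinity>e\<in>{e \<in> E'. norm (S e) = s}. ennreal (norm (S e) powr p))"
    unfolding schatten_pow_def singular_value_set_eq[OF bounded E] E'_def[symmetric]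
    by (rule infsum_cong)
  also have "\<dots> = (\<Sum>\<^sub>\<infinity>e\<in>E'. ennreal (norm (S e) powr p))"
    by (rule infsum_fibres_ennreal[symmetric])
  also have "\<dots> = (\<Sum>\<^sub>\<infinity>e\<in>E. ennreal (norm (S e) powr p))"
    by (intro infsum_cong_neutral) (auto simp: E'_def)
  finally show ?thesis .
qed

section \<open>A weighted power mean inequality\<close>

lemma powr_ge_tangent:
  fixes x m :: real
  assumes "1 \<le> p" "0 \<le> x" "0 < m"
  shows "m powr p + p * m powr (p - 1) * (x - m) \<le> x powr p"
proof (cases "x = 0")
  case True
  have "m powr (p - 1) * m = m powr p"
    using assms powr_mult_base[of m "p - 1"] by (simp add: mult.commute)
  then have "m powr p + p * m powr (p - 1) * (x - m) = (1 - p) * m powr p"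
    using True by (simp add: algebra_simps)
  also have "\<dots> \<le> 0"
    using assms by (simp add: mult_nonpos_nonneg)
  finally show ?thesis
    using True by simp
next
  case False
  have "((\<lambda>x. x powr p) has_field_derivative p * m powr (p - 1)) (at m within {0<..})"
    using assms by (auto intro!: derivative_eq_intros)
  then have "p * m powr (p - 1) * (x - m) \<le> x powr p - m powr p"
    using assms False
    by (intro convex_on_imp_above_tangent[OF powr_convex[OF assms(1)]]) (auto simp: interior_open)
  then show ?thesis
    by simp
qed

text \<open>The tangent inequality at \<open>m\<close>, averaged with the weights \<open>w\<close>.\<close>
lemma mean_powr_le:
  fixes \<sigma> w :: "'i \<Rightarrow> real"
  assumes \<sigma>_nonneg: "\<And>i. i \<in> F \<Longrightarrow> 0 \<le> \<sigma> i" and w_nonneg: "\<And>i. i \<in> F \<Longrightarrow> 0 \<le> w i"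
    and sum_w_le: "sum w F \<le> C" and p_ge_1: "1 \<le> p" and m_pos: "0 < m"
    and mean: "(\<Sum>i\<in>F. \<sigma> i * w i) = C * m"
  shows "C * m powr p \<le> (\<Sum>i\<in>F. \<sigma> i powr p * w i)"
proof -
  have powr_p: "m powr (p - 1) * m = m powr p"
    using m_pos powr_mult_base[of m "p - 1"] by (simp add: mult.commute)
  have "C * m powr p \<le> (sum w F + p * (C - sum w F)) * m powr p"
  proof (rule mult_right_mono)
    show "C \<le> sum w F + p * (C - sum w F)"
      using mult_right_mono[OF p_ge_1, of "C - sum w F"] sum_w_le by simp
  qed simp
  also have "\<dots> = sum w F * m powr p + p * m powr (p - 1) * (C * m - m * sum w F)"
    unfolding powr_p[symmetric] by (simp add: algebra_simps)
  also have "\<dots> = (\<Sum>i\<in>F. (m powr p + p * m powr (p - 1) * (\<sigma> i - m)) * w i)"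
    unfolding mean[symmetric]
    by (simp add: algebra_simps sum.distrib sum_subtractf sum_distrib_left sum_distrib_right)
  also have "\<dots> \<le> (\<Sum>i\<in>F. \<sigma> i powr p * w i)"
    using \<sigma>_nonneg w_nonneg p_ge_1 m_pos by (intro sum_mono mult_right_mono powr_ge_tangent)
  finally show ?thesis .
qed

lemma sum_mult_powr_le:
  fixes \<sigma> w :: "'i \<Rightarrow> real"
  assumes "finite F" and \<sigma>_nonneg: "\<And>i. i \<in> F \<Longrightarrow> 0 \<le> \<sigma> i" and w_nonneg: "\<And>i. i \<in> F \<Longrightarrow> 0 \<le> w i"
    and sum_w_le: "sum w F \<le> C" and p_ge_1: "1 \<le> p"
  shows "(\<Sum>i\<in>F. \<sigma> i * w i) powr p \<le> C powr (p - 1) * (\<Sum>i\<in>F. \<sigma> i powr p * w i)"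
proof (cases "(\<Sum>i\<in>F. \<sigma> i * w i) = 0")
  case True
  then show ?thesis
    using w_nonneg by (simp add: sum_nonneg)
next
  case False
  have "C \<noteq> 0"
  proof
    assume "C = 0"
    then have "sum w F = 0"
      using sum_w_le sum_nonneg[of F w] w_nonneg by simp
    then show False
      using False sum_nonneg_eq_0_iff[OF \<open>finite F\<close> w_nonneg] by simp
  qed
  then have "C > 0"
    using sum_w_le sum_nonneg[of F w] w_nonneg by simp
  define m where "m = (\<Sum>i\<in>F. \<sigma> i * w i) / C"
  have "m > 0"
    using False \<open>C > 0\<close> sum_nonneg[of F "\<lambda>i. \<sigma> i * w i"] \<sigma>_nonneg w_nonneg by (simp add: m_def less_le)
  have mean: "(\<Sum>i\<in>F. \<sigma> i * w i) = C * m"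
    using \<open>C > 0\<close> by (simp add: m_def)
  have "(\<Sum>i\<in>F. \<sigma> i * w i) powr p = C powr (p - 1) * (C * m powr p)"
    unfolding mean using \<open>C > 0\<close> \<open>m > 0\<close> powr_mult_base[of C "p - 1"] by (simp add: powr_mult mult_ac)
  also have "\<dots> \<le> C powr (p - 1) * (\<Sum>i\<in>F. \<sigma> i powr p * w i)"
    by (intro mult_left_mono mean_powr_le \<sigma>_nonneg w_nonneg sum_w_le p_ge_1 \<open>m > 0\<close> mean) simp_all
  finally show ?thesis .
qed

lemma powr_add_le:
  fixes a b :: real
  assumes "1 \<le> p" "0 \<le> a" "0 \<le> b"
  shows "(a + b) powr p \<le> 2 powr (p - 1) * (a powr p + b powr p)"
  using sum_mult_powr_le[of UNIV "\<lambda>c. if c then a else b" "\<lambda>_. 1" 2 p] assms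
  by (simp add: UNIV_bool add.commute)

lemma has_sum_powr_le:
  fixes h :: "'i \<Rightarrow> 'b::real_normed_vector"
  assumes h: "(h has_sum s) E" and h_le: "\<And>i. i \<in> E \<Longrightarrow> norm (h i) \<le> \<sigma> i * w i"
    and \<sigma>_nonneg: "\<And>i. i \<in> E \<Longrightarrow> 0 \<le> \<sigma> i" and w_nonneg: "\<And>i. i \<in> E \<Longrightarrow> 0 \<le> w i"
    and sum_w_le: "\<And>F. finite F \<Longrightarrow> F \<subseteq> E \<Longrightarrow> sum w F \<le> C" and p_ge_1: "1 \<le> p"
  shows "ennreal (norm s powr p) \<le> ennreal (C powr (p - 1)) * (\<Sum>\<^sub>\<infinity>i\<in>E. ennreal (\<sigma> i powr p * w i))"
proof (rule tendsto_upperbound)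
  show "((\<lambda>F. ennreal (norm (sum h F) powr p)) \<longlongrightarrow> ennreal (norm s powr p)) (finite_subsets_at_top E)"
    using h p_ge_1 unfolding has_sum_def
    by (intro tendsto_ennrealI tendsto_powr' tendsto_norm tendsto_const) auto
  have "ennreal (norm (sum h F) powr p)
      \<le> ennreal (C powr (p - 1)) * (\<Sum>\<^sub>\<infinity>i\<in>E. ennreal (\<sigma> i powr p * w i))"
    if F: "finite F" "F \<subseteq> E" for F
  proof -
    have "norm (sum h F) \<le> (\<Sum>i\<in>F. \<sigma> i * w i)"
      using h_le F(2) by (intro sum_norm_le) auto
    then have "norm (sum h F) powr p \<le> (\<Sum>i\<in>F. \<sigma> i * w i) powr p"
      using p_ge_1 by (intro powr_mono2) auto
    also have "\<dots> \<le> C powr (p - 1) * (\<Sum>i\<in>F. \<sigma> i powr p * w i)"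
      using \<sigma>_nonneg w_nonneg F by (intro sum_mult_powr_le sum_w_le p_ge_1) auto
    finally have "ennreal (norm (sum h F) powr p)
        \<le> ennreal (C powr (p - 1)) * ennreal (\<Sum>i\<in>F. \<sigma> i powr p * w i)"
      by (simp add: ennreal_leI flip: ennreal_mult')
    also have "ennreal (\<Sum>i\<in>F. \<sigma> i powr p * w i) = (\<Sum>i\<in>F. ennreal (\<sigma> i powr p * w i))"
      using w_nonneg F by (intro sum_ennreal[symmetric]) auto
    also have "\<dots> \<le> (\<Sum>\<^sub>\<infinity>i\<in>E. ennreal (\<sigma> i powr p * w i))"
      by (rule finite_sum_le_infsum_ennreal[OF F])
    finally show ?thesis
      by (simp add: mult_left_mono)
  qed
  then show "\<forall>\<^sub>F F in finite_subsets_at_top E. ennreal (norm (sum h F) powr p)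
      \<le> ennreal (C powr (p - 1)) * (\<Sum>\<^sub>\<infinity>i\<in>E. ennreal (\<sigma> i powr p * w i))"
    by (auto simp: eventually_finite_subsets_at_top)
qed simp

section \<open>Schatten norms and Bessel families\<close>

lemma cinner_sgn_right: "cinner x (sgn x) = complex_of_real (norm (x::'a::chilbert))"
  by (cases "x = 0")
    (simp_all add: sgn_div_norm cinner_simps cinner_norm power2_eq_square scaleR_conv_of_real)

lemma bessel_on_left_singular_vectors:
  assumes bounded: "bounded_op S" and E: "right_singular_basis S E"
  shows "bessel_on 1 (\<lambda>e. sgn (S e)) E"
proof (rule bessel_on_orthogonal)
  show "pairwise (\<lambda>e e'. cinner (sgn (S e)) (sgn (S e')) = 0) E"
  proof (rule pairwiseI)
    fix e e' assume e: "e \<in> E" "e' \<in> E" "e \<noteq> e'"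
    then have "cinner (S e) (S e') = cinner e ((norm (S e'))\<^sup>2 *\<^sub>R e')"
      using E by (simp add: right_singular_basis_def flip: cinner_adjoint_right[OF bounded])
    then show "cinner (sgn (S e)) (sgn (S e')) = 0"
      using e orthonormal_cinner[OF onb_orthonormal[OF right_singular_basis_onb[OF E]] e(1,2)]
      by (simp add: sgn_div_norm cinner_simps)
  qed
qed (simp add: norm_sgn)

definition singular_weight :: "('a::chilbert \<Rightarrow> 'a) \<Rightarrow> 'a \<Rightarrow> 'a \<Rightarrow> 'a \<Rightarrow> real" where
  "singular_weight S x y e = ((cmod (cinner x e))\<^sup>2 + (cmod (cinner y (sgn (S e))))\<^sup>2) / 2"

lemma singular_weight_nonneg: "0 \<le> singular_weight S x y e"
  by (simp add: singular_weight_def)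

lemma sum_singular_weight_le:
  assumes bounded: "bounded_op S" and E: "right_singular_basis S E"
    and norms_le: "(norm x)\<^sup>2 \<le> C" "(norm y)\<^sup>2 \<le> C" and F: "finite F" "F \<subseteq> E"
  shows "(\<Sum>e\<in>F. singular_weight S x y e) \<le> C"
proof -
  have "(\<Sum>e\<in>F. (cmod (cinner x e))\<^sup>2) \<le> C"
    using bessel_onD[OF bessel_on_orthonormal[OF onb_orthonormal[OF right_singular_basis_onb[OF E]]] F]
      norms_le(1) by (metis mult_1 order_trans)
  moreover have "(\<Sum>e\<in>F. (cmod (cinner y (sgn (S e))))\<^sup>2) \<le> C"
    using bessel_onD[OF bessel_on_left_singular_vectors[OF bounded E] F] norms_le(2)
    by (metis mult_1 order_trans)
  ultimately show ?thesis
    by (simp add: singular_weight_def sum.distrib flip: sum_divide_distrib)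
qed

lemma sum_bessel_singular_weight_le:
  assumes f: "bessel_on C f N" and g: "bessel_on C g N" and "0 \<le> C" and N: "finite N"
    and unit: "norm e = 1"
  shows "(\<Sum>n\<in>N. singular_weight S (f n) (g n) e) \<le> C"
proof -
  have "(\<Sum>n\<in>N. (cmod (cinner (f n) e))\<^sup>2) \<le> C"
    using bessel_onD[OF f N subset_refl, of e] unit by (simp add: cmod_cinner_commute[of e])
  moreover have "(\<Sum>n\<in>N. (cmod (cinner (g n) (sgn (S e))))\<^sup>2) \<le> C"
    using bessel_onD[OF g N subset_refl, of "sgn (S e)"] \<open>0 \<le> C\<close>
    by (simp add: cmod_cinner_commute[of "sgn (S e)"] norm_sgn split: if_splits)
  ultimately show ?thesis
    by (simp add: singular_weight_def sum.distrib flip: sum_divide_distrib)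
qed

lemma cmod_cinner_powr_le_singular_weight:
  assumes bounded: "bounded_op S" and E: "right_singular_basis S E"
    and norms_le: "(norm x)\<^sup>2 \<le> C" "(norm y)\<^sup>2 \<le> C" and p_ge_1: "1 \<le> p"
  shows "ennreal (cmod (cinner (S x) y) powr p)
      \<le> ennreal (C powr (p - 1)) * (\<Sum>\<^sub>\<infinity>e\<in>E. ennreal (norm (S e) powr p * singular_weight S x y e))"
proof (rule has_sum_powr_le[where h="\<lambda>e. cinner x e * cinner (S e) y"])
  show "((\<lambda>e. cinner x e * cinner (S e) y) has_sum cinner (S x) y) E"
    using has_sum_bounded_linear[OF cinner.bounded_linear_left
        bounded_op_expansion[OF right_singular_basis_onb[OF E] bounded]]
    by (simp add: cinner_simps)
  show "cmod (cinner x e * cinner (S e) y) \<le> norm (S e) * singular_weight S x y e" for e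
  proof -
    have "S e = norm (S e) *\<^sub>R sgn (S e)"
      by (cases "S e = 0") (simp_all add: sgn_div_norm)
    then have "cinner (S e) y = norm (S e) *\<^sub>R cinner (sgn (S e)) y"
      by (metis cinner.scaleR_left)
    then have "cmod (cinner x e * cinner (S e) y)
        = norm (S e) * (cmod (cinner x e) * cmod (cinner y (sgn (S e))))"
      by (simp add: norm_mult cmod_cinner_commute)
    also have "\<dots> \<le> norm (S e) * singular_weight S x y e"
      using sum_squares_bound[of "cmod (cinner x e)" "cmod (cinner y (sgn (S e)))"]
      by (intro mult_left_mono) (simp_all add: singular_weight_def)
    finally show ?thesis .
  qed
qed (simp_all add: singular_weight_nonneg sum_singular_weight_le[OF bounded E norms_le] p_ge_1)

theorem bessel_powr_le_schatten_pow:
  fixes S :: "'a::chilbert \<Rightarrow> 'a" and f g :: "'i \<Rightarrow> 'a"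
  assumes S: "compact_op S" and f: "bessel_on C f N" and g: "bessel_on C g N"
    and C_nonneg: "0 \<le> C" and p_ge_1: "1 \<le> p"
  shows "(\<Sum>\<^sub>\<infinity>n\<in>N. ennreal (cmod (cinner (S (f n)) (g n)) powr p))
    \<le> ennreal (C powr p) * schatten_pow p S"
proof (rule infsum_le_finite_sums)
  fix F assume F: "finite F" "F \<subseteq> N"
  have bounded: "bounded_op S"
    by (rule compact_op_bounded_op[OF S])
  obtain E where E: "right_singular_basis S E"
    using right_singular_basis_exists[OF S] .
  define w where "w n e = singular_weight S (f n) (g n) e" for n e
  have "(\<Sum>n\<in>F. ennreal (cmod (cinner (S (f n)) (g n)) powr p))
      \<le> (\<Sum>n\<in>F. ennreal (C powr (p - 1)) * (\<Sum>\<^sub>\<infinity>e\<in>E. ennreal (norm (S e) powr p * w n e)))"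
    unfolding w_def using F f g C_nonneg
    by (intro sum_mono cmod_cinner_powr_le_singular_weight[OF bounded E _ _ p_ge_1]
        bessel_on_norm[where N=N]) auto
  also have "\<dots> = ennreal (C powr (p - 1)) * (\<Sum>\<^sub>\<infinity>e\<in>E. \<Sum>n\<in>F. ennreal (norm (S e) powr p * w n e))"
    by (simp add: sum_infsum_swap_ennreal flip: sum_distrib_left)
  also have "\<dots> \<le> ennreal (C powr (p - 1)) * (\<Sum>\<^sub>\<infinity>e\<in>E. ennreal C * ennreal (norm (S e) powr p))"
  proof (intro mult_left_mono infsum_mono)
    fix e assume "e \<in> E"
    then have "norm e = 1"
      using E right_singular_basis_onb onb_orthonormal orthonormal_norm by blast
    then have "(\<Sum>n\<in>F. w n e) \<le> C"
      unfolding w_def using f g F C_nonneg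
      by (intro sum_bessel_singular_weight_le) (auto simp: bessel_on_def)
    then show "(\<Sum>n\<in>F. ennreal (norm (S e) powr p * w n e)) \<le> ennreal C * ennreal (norm (S e) powr p)"
      by (intro sum_ennreal_mult_le) (simp_all add: w_def singular_weight_nonneg)
  qed simp_all
  also have "\<dots> = ennreal (C powr (p - 1) * C) * schatten_pow p S"
    using C_nonneg
    by (simp add: infsum_cmult_ennreal schatten_pow_eq_infsum[OF bounded E] ennreal_mult mult.assoc)
  also have "C powr (p - 1) * C = C powr p"
    using powr_mult_base[OF C_nonneg, of "p - 1"] by (simp add: mult.commute)
  finally show "(\<Sum>n\<in>F. ennreal (cmod (cinner (S (f n)) (g n)) powr p))
      \<le> ennreal (C powr p) * schatten_pow p S" .
qed simp

lemma norm_add_powr_le: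
  fixes x y :: "'a::chilbert"
  assumes "1 \<le> p"
  defines "v \<equiv> sgn (x + y)"
  shows "norm (x + y) powr p \<le> 2 powr (p - 1) * (cmod (cinner x v) powr p + cmod (cinner y v) powr p)"
proof -
  have "norm (x + y) = cmod (cinner (x + y) v)"
    by (simp add: v_def cinner_sgn_right)
  also have "\<dots> \<le> cmod (cinner x v) + cmod (cinner y v)"
    by (simp only: cinner.add_left norm_triangle_ineq)
  finally have "norm (x + y) powr p \<le> (cmod (cinner x v) + cmod (cinner y v)) powr p"
    using assms(1) by (intro powr_mono2) auto
  also have "\<dots> \<le> 2 powr (p - 1) * (cmod (cinner x v) powr p + cmod (cinner y v) powr p)"
    using assms(1) by (intro powr_add_le) auto
  finally show ?thesis .
qed

theorem schatten_pow_add_le: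
  fixes A B :: "'a::chilbert \<Rightarrow> 'a"
  assumes A: "compact_op A" and B: "compact_op B" and p_ge_1: "1 \<le> p"
  shows "schatten_pow p (\<lambda>x. A x + B x)
    \<le> ennreal (2 powr (p - 1)) * (schatten_pow p A + schatten_pow p B)"
proof -
  define S where "S x = A x + B x" for x
  have S: "compact_op S"
    unfolding S_def by (rule compact_op_add[OF A B])
  note bounded = compact_op_bounded_op[OF S]
  obtain E where E: "right_singular_basis S E"
    using right_singular_basis_exists[OF S] .
  define v where "v e = sgn (S e)" for e
  define a where "a e = cmod (cinner (A e) (v e)) powr p" for e
  define b where "b e = cmod (cinner (B e) (v e)) powr p" for e
  have v: "bessel_on 1 v E"
    unfolding v_def by (rule bessel_on_left_singular_vectors[OF bounded E])
  have identity: "bessel_on 1 (\<lambda>e. e) E"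
    by (intro bessel_on_orthonormal onb_orthonormal right_singular_basis_onb[OF E])
  have "norm (S e) powr p \<le> 2 powr (p - 1) * (a e + b e)" for e
    unfolding a_def b_def v_def S_def by (rule norm_add_powr_le[OF p_ge_1])
  then have "(\<Sum>\<^sub>\<infinity>e\<in>E. ennreal (norm (S e) powr p))
      \<le> (\<Sum>\<^sub>\<infinity>e\<in>E. ennreal (2 powr (p - 1)) * (ennreal (a e) + ennreal (b e)))"
    by (intro infsum_mono) (simp_all add: a_def b_def ennreal_leI flip: ennreal_plus ennreal_mult)
  also have "\<dots> = ennreal (2 powr (p - 1)) * ((\<Sum>\<^sub>\<infinity>e\<in>E. ennreal (a e)) + (\<Sum>\<^sub>\<infinity>e\<in>E. ennreal (b e)))"
    by (simp add: infsum_cmult_ennreal infsum_add)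
  also have "\<dots> \<le> ennreal (2 powr (p - 1)) * (schatten_pow p A + schatten_pow p B)"
    unfolding a_def b_def
    using bessel_powr_le_schatten_pow[OF A identity v _ p_ge_1]
      bessel_powr_le_schatten_pow[OF B identity v _ p_ge_1]
    by (intro mult_left_mono add_mono) simp_all
  finally show ?thesis
    by (simp add: schatten_pow_eq_infsum[OF bounded E] flip: S_def)
qed

lemma schatten_pow_scaleC:
  fixes T :: "'a::chilbert \<Rightarrow> 'a"
  assumes T: "compact_op T"
  shows "schatten_pow p (\<lambda>x. scaleC c (T x)) = ennreal (cmod c powr p) * schatten_pow p T"
proof -
  note bounded = compact_op_bounded_op[OF T]
  obtain E where E: "right_singular_basis T E"
    using right_singular_basis_exists[OF T] .
  have "right_singular_basis (\<lambda>x. scaleC c (T x)) E"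
    using E bounded_op_commute_scaleC[OF bounded_op_adjoint[OF bounded]]
    by (simp add: right_singular_basis_def adjoint_scaleC[OF bounded] scaleC_scaleC norm_scaleC
        power_mult_distrib mult.commute complex_norm_square[symmetric] scaleC_scaleR
        del: of_real_power flip: scaleR_scaleR)
  then have "schatten_pow p (\<lambda>x. scaleC c (T x)) = (\<Sum>\<^sub>\<infinity>e\<in>E. ennreal (norm (scaleC c (T e)) powr p))"
    by (rule schatten_pow_eq_infsum[OF bounded_op_comp[OF bounded_op_scaleC bounded]])
  also have "\<dots> = ennreal (cmod c powr p) * schatten_pow p T"
    by (simp add: norm_scaleC powr_mult ennreal_mult infsum_cmult_ennreal
        schatten_pow_eq_infsum[OF bounded E])
  finally show ?thesis .
qed

section \<open>Diagonal sums over orthonormal bases\<close>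

definition diagonal_pow :: "real \<Rightarrow> ('a::chilbert \<Rightarrow> 'a) \<Rightarrow> ('i \<Rightarrow> 'a) \<Rightarrow> 'i set \<Rightarrow> ennreal" where
  "diagonal_pow p S f N = (\<Sum>\<^sub>\<infinity>n\<in>N. ennreal (cmod (cinner (S (f n)) (f n)) powr p))"

lemma diagonal_pow_less_top_iff:
  "diagonal_pow p S f N < top \<longleftrightarrow> (\<lambda>n. cmod (cinner (S (f n)) (f n)) powr p) summable_on N"
  unfolding diagonal_pow_def by (rule summable_on_iff_infsum_ennreal_less_top[symmetric]) simp

lemma diagonal_pow_nat: "diagonal_pow p S f UNIV = (\<Sum>n. ennreal (cmod (cinner (S (f n)) (f n)) powr p))"
  by (simp add: diagonal_pow_def suminf_eq_infsum_ennreal)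

lemma diagonal_pow_nat_less_top_iff:
  "diagonal_pow p S f UNIV < top \<longleftrightarrow> summable (\<lambda>n. cmod (cinner (S (f n)) (f n)) powr p)"
  by (simp add: diagonal_pow_less_top_iff summable_on_UNIV_nonneg_real_iff)

lemma diagonal_pow_mono:
  assumes "\<And>n. n \<in> N \<Longrightarrow> cmod (cinner (S (f n)) (f n)) \<le> cmod (cinner (T (f n)) (f n))" "0 \<le> p"
  shows "diagonal_pow p S f N \<le> diagonal_pow p T f N"
  unfolding diagonal_pow_def using assms by (intro infsum_mono ennreal_leI powr_mono2) auto

lemma diagonal_pow_le_schatten_pow:
  assumes "compact_op S" "bessel_on C f N" "0 \<le> C" "1 \<le> p"
  shows "diagonal_pow p S f N \<le> ennreal (C powr p) * schatten_pow p S"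
  unfolding diagonal_pow_def using bessel_powr_le_schatten_pow[OF assms(1,2,2,3,4)] .

lemma onb_diagonal_pow_le_schatten_pow:
  assumes "compact_op S" "onb E" "1 \<le> p"
  shows "diagonal_pow p S (\<lambda>e. e) E \<le> schatten_pow p S"
  using diagonal_pow_le_schatten_pow[OF assms(1)
      bessel_on_orthonormal[OF onb_orthonormal[OF assms(2)]] _ assms(3)] by simp

lemma self_adjoint_diagonal_pow_attained:
  fixes S :: "'a::chilbert \<Rightarrow> 'a"
  assumes S: "compact_op S" "self_adjoint S"
  obtains E where "onb E" "schatten_pow p S = diagonal_pow p S (\<lambda>e. e) E"
proof -
  have bounded: "bounded_op S"
    by (rule compact_op_bounded_op[OF S(1)])
  interpret S: bounded_linear S
    by (rule bounded_op_bounded_linear[OF bounded])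
  obtain E \<alpha> where E: "onb E" and \<alpha>: "\<And>e. e \<in> E \<Longrightarrow> S e = \<alpha> e *\<^sub>R e"
    using compact_self_adjoint_eigenbasis[OF S] by blast
  have abs_eigenvalue: "norm (S e) = \<bar>\<alpha> e\<bar>" "cmod (cinner (S e) e) = \<bar>\<alpha> e\<bar>" if "e \<in> E" for e
    using orthonormal_norm[OF onb_orthonormal[OF E] that]
    by (simp_all add: \<alpha>[OF that] cinner_simps cinner_norm)
  have "adjoint S (S e) = (norm (S e))\<^sup>2 *\<^sub>R e" if "e \<in> E" for e
    unfolding abs_eigenvalue(1)[OF that] self_adjoint_adjoint[OF S(2)]
    by (simp add: \<alpha>[OF that] S.scaleR power2_eq_square)
  with E have "right_singular_basis S E"
    by (simp add: right_singular_basis_def)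
  then have "schatten_pow p S = (\<Sum>\<^sub>\<infinity>e\<in>E. ennreal (norm (S e) powr p))"
    by (rule schatten_pow_eq_infsum[OF bounded])
  also have "\<dots> = diagonal_pow p S (\<lambda>e. e) E"
    unfolding diagonal_pow_def by (rule infsum_cong) (simp add: abs_eigenvalue)
  finally show thesis
    by (rule that[OF E])
qed

theorem schatten_pow_eq_SUP_onb:
  assumes S: "compact_op S" "self_adjoint S" and p_ge_1: "1 \<le> p"
  shows "schatten_pow p S = (SUP E\<in>{E. onb E}. diagonal_pow p S (\<lambda>e. e) E)"
proof (rule antisym)
  obtain E where "onb E" "schatten_pow p S = diagonal_pow p S (\<lambda>e. e) E"
    using self_adjoint_diagonal_pow_attained[OF S] by blast
  then show "schatten_pow p S \<le> (SUP E\<in>{E. onb E}. diagonal_pow p S (\<lambda>e. e) E)"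
    by (intro SUP_upper2[of E]) auto
  show "(SUP E\<in>{E. onb E}. diagonal_pow p S (\<lambda>e. e) E) \<le> schatten_pow p S"
    using onb_diagonal_pow_le_schatten_pow[OF S(1) _ p_ge_1] by (intro SUP_least) simp
qed

definition hermitian_part :: "('a::chilbert \<Rightarrow> 'a) \<Rightarrow> 'a \<Rightarrow> 'a" where
  "hermitian_part S x = scaleC (1/2) (S x + adjoint S x)"

lemma compact_op_hermitian_part: "compact_op S \<Longrightarrow> compact_op (hermitian_part S)"
  unfolding hermitian_part_def [abs_def] by (intro compact_op_scaleC compact_op_add compact_op_adjoint)

lemma self_adjoint_hermitian_part: "bounded_op S \<Longrightarrow> self_adjoint (hermitian_part S)"
  by (simp add: self_adjoint_def hermitian_part_def cinner_simps cinner_adjoint_left cinner_adjoint_right)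

lemma cinner_hermitian_part:
  "bounded_op S \<Longrightarrow> cinner (hermitian_part S x) x = complex_of_real (Re (cinner (S x) x))"
  using cinner_commute[of x "S x"]
  by (simp add: hermitian_part_def cinner_simps cinner_adjoint_left complex_eq_iff)

lemma hermitian_part_decomposition:
  assumes "bounded_op S"
  shows "S x = hermitian_part S x + scaleC \<i> (hermitian_part (\<lambda>y. scaleC (- \<i>) (S y)) x)"
proof -
  have "hermitian_part S x + scaleC \<i> (hermitian_part (\<lambda>y. scaleC (- \<i>) (S y)) x)
      = scaleC (1/2 + 1/2) (S x)"
    unfolding hermitian_part_def adjoint_scaleC[OF assms]
    by (simp only: scaleC.add_right scaleC.add_left scaleC_scaleC) (simp add: scaleC.minus_left)
  then show ?thesis
    by (simp add: scaleC_one)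
qed

lemma schatten_pow_hermitian_part_finite:
  fixes S :: "'a::chilbert \<Rightarrow> 'a"
  assumes S: "compact_op S" and p_nonneg: "0 \<le> p"
    and finite: "\<And>E. onb E \<Longrightarrow> diagonal_pow p S (\<lambda>e. e) E < top"
  shows "schatten_pow p (hermitian_part S) < top"
proof -
  note bounded = compact_op_bounded_op[OF S]
  obtain E where E: "onb E"
      "schatten_pow p (hermitian_part S) = diagonal_pow p (hermitian_part S) (\<lambda>e. e) E"
    using self_adjoint_diagonal_pow_attained[OF compact_op_hermitian_part[OF S]
        self_adjoint_hermitian_part[OF bounded]] by blast
  have "diagonal_pow p (hermitian_part S) (\<lambda>e. e) E \<le> diagonal_pow p S (\<lambda>e. e) E"
    by (intro diagonal_pow_mono p_nonneg) (simp add: cinner_hermitian_part[OF bounded] abs_Re_le_cmod)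
  also have "\<dots> < top"
    by (rule finite[OF E(1)])
  finally show ?thesis
    by (simp add: E(2))
qed

theorem onb_diagonal_pow_finite_imp_schatten_pow_finite:
  fixes S :: "'a::chilbert \<Rightarrow> 'a"
  assumes S: "compact_op S" and p_ge_1: "1 \<le> p"
    and finite: "\<And>E. onb E \<Longrightarrow> diagonal_pow p S (\<lambda>e. e) E < top"
  shows "schatten_pow p S < top"
proof -
  define A where "A = hermitian_part S"
  define B where "B = hermitian_part (\<lambda>x. scaleC (- \<i>) (S x))"
  have rotated: "compact_op (\<lambda>x. scaleC (- \<i>) (S x))"
    by (rule compact_op_scaleC[OF S])
  have compact: "compact_op A" "compact_op B"
    unfolding A_def B_def by (intro compact_op_hermitian_part S rotated)+
  have "schatten_pow p A < top"
    unfolding A_def using p_ge_1 by (intro schatten_pow_hermitian_part_finite S finite) auto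
  moreover have "schatten_pow p B < top"
    unfolding B_def using p_ge_1 finite
    by (intro schatten_pow_hermitian_part_finite rotated)
      (simp_all add: diagonal_pow_def cinner_simps norm_mult)
  moreover have "schatten_pow p S = schatten_pow p (\<lambda>x. A x + scaleC \<i> (B x))"
    unfolding A_def B_def by (simp flip: hermitian_part_decomposition[OF compact_op_bounded_op[OF S]])
  moreover have "schatten_pow p (\<lambda>x. A x + scaleC \<i> (B x))
      \<le> ennreal (2 powr (p - 1)) * (schatten_pow p A + schatten_pow p B)"
    using schatten_pow_add_le[OF compact(1) compact_op_scaleC[OF compact(2), of \<i>] p_ge_1]
      schatten_pow_scaleC[OF compact(2), of p \<i>] by simp
  ultimately show ?thesis
    by (simp add: ennreal_mult_less_top le_less_trans)
qed

section \<open>Diagonal sums over frames\<close>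

lemma frame_bounds_bessel_on:
  assumes "frame_bounds f C1 C2"
  shows "bessel_on C2 f UNIV"
  unfolding bessel_on_def
proof (intro allI impI)
  fix F :: "nat set" and x assume "finite F"
  then have "(\<Sum>n\<in>F. (cmod (cinner x (f n)))\<^sup>2) \<le> (\<Sum>n. (cmod (cinner x (f n)))\<^sup>2)"
    using assms by (intro sum_le_suminf) (auto simp: frame_bounds_def)
  also have "\<dots> \<le> C2 * (norm x)\<^sup>2"
    using assms by (simp add: frame_bounds_def)
  finally show "(\<Sum>n\<in>F. (cmod (cinner x (f n)))\<^sup>2) \<le> C2 * (norm x)\<^sup>2" .
qed

lemma upper_frame_bound_le: "frame_bounds f C1 C2 \<Longrightarrow> upper_frame_bound f \<le> C2"
  unfolding upper_frame_bound_def
  by (rule cInf_lower) (auto intro!: bdd_belowI[where m=0] simp: frame_bounds_def)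

lemma upper_frame_bound_bessel_on:
  assumes "frame f" "upper_frame_bound f \<le> C"
  shows "bessel_on C f UNIV"
  unfolding bessel_on_def
proof (intro allI impI)
  fix F :: "nat set" and x assume F: "finite F" "F \<subseteq> UNIV"
  define t where "t = (\<Sum>n\<in>F. (cmod (cinner x (f n)))\<^sup>2)"
  have t_le: "t \<le> C2 * (norm x)\<^sup>2" if "frame_bounds f C1 C2" for C1 C2
    unfolding t_def by (rule bessel_onD[OF frame_bounds_bessel_on[OF that] F])
  show "t \<le> C * (norm x)\<^sup>2"
  proof (cases "x = 0")
    case False
    have "t / (norm x)\<^sup>2 \<le> upper_frame_bound f"
      unfolding upper_frame_bound_def
    proof (rule cInf_greatest)
      show "{C2. \<exists>C1. frame_bounds f C1 C2} \<noteq> {}"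
        using assms(1) by (auto simp: frame_def)
      show "t / (norm x)\<^sup>2 \<le> C2" if "C2 \<in> {C2. \<exists>C1. frame_bounds f C1 C2}" for C2
        using that t_le False by (auto simp: divide_le_eq)
    qed
    also have "\<dots> \<le> C"
      by (fact assms(2))
    finally show ?thesis
      using False by (simp add: divide_le_eq)
  qed (simp add: t_def cinner_simps)
qed

text \<open>Frames are indexed by all natural numbers, so a finite basis is padded with zero vectors.\<close>
definition padded_enumeration :: "'a::chilbert set \<Rightarrow> nat \<Rightarrow> 'a" where
  "padded_enumeration E n = (if n \<in> to_nat_on E ` E then from_nat_into E n else 0)"

lemma has_sum_padded_enumeration:
  assumes countable_E: "countable E" and h_zero: "h 0 = 0"
  shows "((\<lambda>n. h (padded_enumeration E n)) has_sum s) UNIV \<longleftrightarrow> (h has_sum s) E"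
proof -
  have "((\<lambda>n. h (padded_enumeration E n)) has_sum s) UNIV \<longleftrightarrow>
      ((\<lambda>n. h (padded_enumeration E n)) has_sum s) (to_nat_on E ` E)"
    by (rule has_sum_cong_neutral) (auto simp: padded_enumeration_def h_zero)
  also have "\<dots> \<longleftrightarrow> (((\<lambda>n. h (padded_enumeration E n)) \<circ> to_nat_on E) has_sum s) E"
    by (rule has_sum_reindex[OF inj_on_to_nat_on[OF countable_E]])
  also have "\<dots> \<longleftrightarrow> (h has_sum s) E"
    by (rule has_sum_cong) (simp add: padded_enumeration_def countable_E)
  finally show ?thesis .
qed

lemma frame_bounds_padded_enumeration:
  assumes E: "onb E" "countable E"
  shows "frame_bounds (padded_enumeration E) 1 1"
proof -
  have "(\<lambda>n. (cmod (cinner x (padded_enumeration E n)))\<^sup>2) sums (norm x)\<^sup>2" for x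
    using has_sum_padded_enumeration[OF E(2), of "\<lambda>e. (cmod (cinner x e))\<^sup>2"]
      parseval_norm[OF E(1), of x]
    by (simp add: has_sum_imp_sums cinner_simps)
  then show ?thesis
    unfolding frame_bounds_def by (auto simp: sums_iff)
qed

lemma diagonal_pow_padded_enumeration:
  assumes "countable E" "S 0 = 0"
  shows "diagonal_pow p S (padded_enumeration E) UNIV = diagonal_pow p S (\<lambda>e. e) E"
proof -
  define h where "h x = ennreal (cmod (cinner (S x) x) powr p)" for x
  have "((\<lambda>n. h (padded_enumeration E n)) has_sum infsum h E) UNIV"
    using assms by (subst has_sum_padded_enumeration) (simp_all add: h_def cinner_simps)
  then show ?thesis
    unfolding diagonal_pow_def h_def[symmetric] by (rule infsumI)
qed

theorem frame_diagonal_pow_finite: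
  assumes S: "compact_op S" and p_ge_1: "1 \<le> p" and "schatten_pow p S < top" and "frame f"
  shows "diagonal_pow p S f UNIV < top"
proof -
  obtain C1 C where f: "frame_bounds f C1 C"
    using \<open>frame f\<close> by (auto simp: frame_def)
  then have "0 \<le> C"
    by (simp add: frame_bounds_def)
  with f have "diagonal_pow p S f UNIV \<le> ennreal (C powr p) * schatten_pow p S"
    by (intro diagonal_pow_le_schatten_pow S frame_bounds_bessel_on p_ge_1)
  also have "\<dots> < top"
    using assms(3) by (simp add: ennreal_mult_less_top)
  finally show ?thesis .
qed

lemma compact_op_apply_zero: "compact_op S \<Longrightarrow> S 0 = 0"
  by (simp add: linear_0 bounded_linear.linear bounded_op_bounded_linear compact_op_bounded_op)

lemma onb_diagonal_pow_eq_frame_diagonal_pow: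
  fixes S :: "'a::chilbert \<Rightarrow> 'a"
  assumes "separable TYPE('a)" and S: "compact_op S" and E: "onb E"
  obtains f where "frame f" "upper_frame_bound f \<le> 1"
    "diagonal_pow p S f UNIV = diagonal_pow p S (\<lambda>e. e) E"
proof
  have countable: "countable E"
    by (rule orthonormal_countable[OF assms(1) onb_orthonormal[OF E]])
  note bounds = frame_bounds_padded_enumeration[OF E countable]
  show "frame (padded_enumeration E)"
    using bounds by (auto simp: frame_def)
  show "upper_frame_bound (padded_enumeration E) \<le> 1"
    by (rule upper_frame_bound_le[OF bounds])
  show "diagonal_pow p S (padded_enumeration E) UNIV = diagonal_pow p S (\<lambda>e. e) E"
    by (rule diagonal_pow_padded_enumeration[where S=S, OF countable compact_op_apply_zero[OF S]])
qed

theorem schatten_pow_eq_SUP_frame: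
  fixes S :: "'a::chilbert \<Rightarrow> 'a"
  assumes "separable TYPE('a)" and S: "compact_op S" "self_adjoint S" and p_ge_1: "1 \<le> p"
  shows "schatten_pow p S = (SUP f\<in>{f. frame f \<and> upper_frame_bound f \<le> 1}. diagonal_pow p S f UNIV)"
proof (rule antisym)
  obtain E where E: "onb E" "schatten_pow p S = diagonal_pow p S (\<lambda>e. e) E"
    using self_adjoint_diagonal_pow_attained[OF S] by blast
  then obtain f where "frame f" "upper_frame_bound f \<le> 1" "schatten_pow p S = diagonal_pow p S f UNIV"
    using onb_diagonal_pow_eq_frame_diagonal_pow[OF assms(1) S(1) E(1)] by metis
  then show "schatten_pow p S \<le> (SUP f\<in>{f. frame f \<and> upper_frame_bound f \<le> 1}. diagonal_pow p S f UNIV)"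
    by (intro SUP_upper2[of f]) auto
  show "(SUP f\<in>{f. frame f \<and> upper_frame_bound f \<le> 1}. diagonal_pow p S f UNIV) \<le> schatten_pow p S"
    using diagonal_pow_le_schatten_pow[OF S(1) upper_frame_bound_bessel_on _ p_ge_1, of _ 1]
    by (intro SUP_least) simp
qed

theorem theorem7:
  fixes S :: "'a::chilbert \<Rightarrow> 'a" and p :: real
  assumes "separable TYPE('a)"
    and "1 \<le> p"
    and "compact_op S"
  shows "(in_Sp p S \<longleftrightarrow>
            (\<forall>E. onb E \<longrightarrow> (\<lambda>e. cmod (cinner (S e) e) powr p) summable_on E))
       \<and> (in_Sp p S \<longleftrightarrow>
            (\<forall>f. frame f \<longrightarrow> summable (\<lambda>n. cmod (cinner (S (f n)) (f n)) powr p)))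
       \<and> (self_adjoint S \<longrightarrow>
         schatten_pow p S =
           (SUP E\<in>{E. onb E}. \<Sum>\<^sub>\<infinity>e\<in>E. ennreal (cmod (cinner (S e) e) powr p))
       \<and> schatten_pow p S =
           (SUP f\<in>{f. frame f \<and> upper_frame_bound f \<le> 1}.
              \<Sum>n. ennreal (cmod (cinner (S (f n)) (f n)) powr p)))"
proof -
  define onb_finite where "onb_finite \<longleftrightarrow> (\<forall>E. onb E \<longrightarrow> diagonal_pow p S (\<lambda>e. e) E < top)"
  define frame_finite where "frame_finite \<longleftrightarrow> (\<forall>f. frame f \<longrightarrow> diagonal_pow p S f UNIV < top)"
  have "in_Sp p S \<Longrightarrow> frame_finite"
    unfolding frame_finite_def in_Sp_def using frame_diagonal_pow_finite assms(2) by blast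
  moreover have "frame_finite \<Longrightarrow> onb_finite"
    unfolding frame_finite_def onb_finite_def
    using onb_diagonal_pow_eq_frame_diagonal_pow[OF assms(1,3)] by metis
  moreover have "onb_finite \<Longrightarrow> in_Sp p S"
    unfolding onb_finite_def in_Sp_def
    using onb_diagonal_pow_finite_imp_schatten_pow_finite assms(2,3) by blast
  moreover have "onb_finite \<longleftrightarrow> (\<forall>E. onb E \<longrightarrow> (\<lambda>e. cmod (cinner (S e) e) powr p) summable_on E)"
    unfolding onb_finite_def diagonal_pow_less_top_iff ..
  moreover have "frame_finite \<longleftrightarrow>
      (\<forall>f. frame f \<longrightarrow> summable (\<lambda>n. cmod (cinner (S (f n)) (f n)) powr p))"
    unfolding frame_finite_def diagonal_pow_nat_less_top_iff ..
  ultimately show ?thesis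
    using schatten_pow_eq_SUP_onb[OF assms(3) _ assms(2), unfolded diagonal_pow_def]
      schatten_pow_eq_SUP_frame[OF assms(1,3) _ assms(2), unfolded diagonal_pow_nat] by blast
qed

end
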